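(* Let $(X_n)_{n\ge1}$ be a sequence of random variables on a probability space $(\Omega,\mathcal{A},P)$ with values in a measurable space $(E,\mathcal{E})$, and let $\mathcal{I}$ be the shift-invariant $\sigma$-field of $(X_n)_n$. The following statements are equivalent: (i) $(X_n)_n$ is exchangeable; (ii) for any $H\in\mathcal{I}$ with $P(H)>0$, $(X_n)_n$ is c.i.d. under $P(\cdot\mid H)$; (iii) for any finite permutation $\tau$ of $\{1,2,\dots\}$, $(X_{\tau(n)})_{n\ge 1}$ is c.i.d. (under $P$).
   Context: A sequence $(Y_n)_{n\ge1}$ of $E$-valued random variables is c.i.d. (conditionally identically distributed) under a probability $Q$ if, with $\mathcal{G}^Y_0=\{\varnothing,\Omega\}$ and $\mathcal{G}^Y_n=\sigma(Y_1,\dots,Y_n)$, one has $E_Q[f(Y_k)\mid\mathcal{G}^Y_n]=E_Q[f(Y_{n+1})\mid\mathcal{G}^Y_n]$ $Q$-a.s. for all $k>n\ge0$ and all bounded measurable $f:E\to\mathbb{R}$; equivalently, $[Y_1,\dots,Y_n,Y_{n+2}]$ and $[Y_1,\dots,Y_n,Y_{n+1}]$ have the same distribution under $Q$ for all $n\ge0$. A finite permutation of $\{1,2,\dots\}$ is a bijection $\tau$ of $\{1,2,\dots\}$ with $\tau(n)=n$ for all but finitely many $n$. $(X_n)_n$ is exchangeable if $(X_{\tau(n)})_n$ has the same distribution as $(X_n)_n$ for every finite permutation $\tau$. The shift-invariant $\sigma$-field of $(X_n)_n$ is $\mathcal{I}=\{\{(X_1,X_2,\dots)\in B\}: B\in\mathcal{E}^\infty,\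 \theta^{-1}B=B\}$, where $\theta(x_1,x_2,\dots)=(x_2,x_3,\dots)$ is the shift on $E^\infty$. *)

theory Defs
  imports "HOL-Probability.Probability"
begin

text \<open>
  Sequences are indexed from 0: the paper's \<open>X\<^sub>1, X\<^sub>2, \<dots>\<close> are \<open>X 0, X 1, \<dots>\<close>. A measurable space
  \<open>(E, \<E>)\<close> is represented by a measure, of which only the space and the measurable sets are used.
\<close>

definition seq_space :: "'e measure \<Rightarrow> (nat \<Rightarrow> 'e) measure" where
  "seq_space E = (\<Pi>\<^sub>M n\<in>UNIV. E)"

definition finite_permutation :: "(nat \<Rightarrow> nat) \<Rightarrow> bool" where
  "finite_permutation \<tau> \<longleftrightarrow> bij \<tau> \<and> finite {n. \<tau> n \<noteq> n}"

definition exchangeable :: "'w measure \<Rightarrow> 'e measure \<Rightarrow> (nat \<Rightarrow> 'w \<Rightarrow> 'e) \<Rightarrow> bool" where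
  "exchangeable P E X \<longleftrightarrow>
     (\<forall>\<tau>. finite_permutation \<tau> \<longrightarrow>
        distr P (seq_space E) (\<lambda>\<omega> n. X (\<tau> n) \<omega>) = distr P (seq_space E) (\<lambda>\<omega> n. X n \<omega>))"

text \<open>The sigma-field generated by the first \<open>n\<close> variables; it is trivial for \<open>n = 0\<close>.\<close>

definition gen_filtration :: "'w measure \<Rightarrow> 'e measure \<Rightarrow> (nat \<Rightarrow> 'w \<Rightarrow> 'e) \<Rightarrow> nat \<Rightarrow> 'w measure" where
  "gen_filtration Q E Y n = sigma (space Q) {Y i -` A \<inter> space Q | i A. i < n \<and> A \<in> sets E}"

text \<open>
  Because of the indexing from 0, \<open>Y n\<close> is the first variable after those generating
  \<open>gen_filtration Q E Y n\<close>, and \<open>k\<close> runs over \<open>k \<ge> n\<close>.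
\<close>

definition cid :: "'w measure \<Rightarrow> 'e measure \<Rightarrow> (nat \<Rightarrow> 'w \<Rightarrow> 'e) \<Rightarrow> bool" where
  "cid Q E Y \<longleftrightarrow>
     (\<forall>n. \<forall>k\<ge>n. \<forall>f :: 'e \<Rightarrow> real. f \<in> borel_measurable E \<longrightarrow> bounded (f ` space E) \<longrightarrow>
        (AE \<omega> in Q. real_cond_exp Q (gen_filtration Q E Y n) (\<lambda>\<omega>. f (Y k \<omega>)) \<omega>
                   = real_cond_exp Q (gen_filtration Q E Y n) (\<lambda>\<omega>. f (Y n \<omega>)) \<omega>))"

definition seq_shift :: "(nat \<Rightarrow> 'e) \<Rightarrow> nat \<Rightarrow> 'e" where
  "seq_shift x = (\<lambda>n. x (Suc n))"

definition shift_invariant_sets :: "'w measure \<Rightarrow> 'e measure \<Rightarrow> (nat \<Rightarrow> 'w \<Rightarrow> 'e) \<Rightarrow> 'w set set" where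
  "shift_invariant_sets P E X =
     {{\<omega> \<in> space P. (\<lambda>n. X n \<omega>) \<in> B} | B.
        B \<in> sets (seq_space E) \<and> seq_shift -` B \<inter> space (seq_space E) = B}"

end

theory Submission
  imports Defs
begin

text \<open>
  Both converse implications reduce to cylinder events. For (iii) \<open>\<Longrightarrow>\<close> (i), the c.i.d. property of a
  rearranged sequence says that one coordinate of a finite marginal may be exchanged for a fresh one;
  moving all coordinates to fresh indices one at a time shows that the marginal along an injection does
  not depend on the injection.

  For (ii) \<open>\<Longrightarrow>\<close> (i), let \<open>Z\<^sub>k\<close> be the indicator of \<open>X\<^sub>k \<in> B\<close>. By the c.i.d. property
  \<open>E[Z\<^sub>k Z\<^sub>l]\<close> for \<open>k < l\<close> depends only on \<open>k\<close>, and positivity of the Gram matrix forces it to converge.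
  Hence the averages of \<open>Z\<^sub>m, \<dots>, Z\<^sub>2\<^sub>m\<close> are Cauchy in \<open>L\<^sup>2\<close>, and along a subsequence they converge almost
  surely to a shift-invariant \<open>V\<^sub>B\<close>. The c.i.d. property under all \<open>P(\<cdot> | H)\<close> then lets one replace
  \<open>Z\<^sub>n\<close> by \<open>V\<^sub>B\<close> in expectations against \<open>\<I>\<close>-measurable functions times events of the first \<open>n\<close> variables,
  so \<open>P(X\<^sub>0 \<in> A\<^sub>0, \<dots>, X\<^sub>n \<in> A\<^sub>n) = E[V\<^bsub>A\<^sub>0\<^esub> \<cdots> V\<^bsub>A\<^sub>n\<^esub>]\<close>, which is symmetric in the \<open>A\<^sub>i\<close>.
\<close>

subsection \<open>The c.i.d. property on cylinders\<close>

lemma space_gen_filtration [simp]: "space (gen_filtration Q E Y n) = space Q"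
  by (simp add: gen_filtration_def space_measure_of_conv)

text \<open>The events in the definition constrain a single coordinate and are not stable under
  intersection. Cylinders with one constraint per coordinate are, so they can serve as the pi-system
  in \<open>cid_iff\<close>.\<close>

lemma sets_gen_filtration_cylinders:
  assumes "\<And>n. Y n \<in> measurable Q E"
  shows "sets (gen_filtration Q E Y n)
    = sigma_sets (space Q) {{\<omega> \<in> space Q. \<forall>i<n. Y i \<omega> \<in> A i} | A. \<forall>i. A i \<in> sets E}"
    (is "_ = sigma_sets _ ?C")
proof -
  let ?G = "{Y i -` A \<inter> space Q | i A. i < n \<and> A \<in> sets E}"
  have "sigma_sets (space Q) ?G = sigma_sets (space Q) ?C"
  proof (rule sigma_sets_eqI)
    fix a assume "a \<in> ?G"
    then obtain i A where a: "a = Y i -` A \<inter> space Q" "i < n" "A \<in> sets E" by blast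
    have "a = {\<omega> \<in> space Q. \<forall>j<n. Y j \<omega> \<in> (if j = i then A else space E)}"
      using a measurable_space[OF assms] by auto
    moreover have "\<forall>j. (if j = i then A else space E) \<in> sets E" using a by simp
    ultimately have "a \<in> ?C"
      by (intro CollectI exI[where x="\<lambda>j. if j = i then A else space E"]) simp
    then show "a \<in> sigma_sets (space Q) ?C" by blast
  next
    fix b assume "b \<in> ?C"
    then obtain A where b: "b = {\<omega> \<in> space Q. \<forall>i<n. Y i \<omega> \<in> A i}" and A: "\<forall>i. A i \<in> sets E"
      by blast
    interpret S: sigma_algebra "space Q" "sigma_sets (space Q) ?G"
      by (rule sigma_algebra_sigma_sets) auto
    have "{\<omega> \<in> space Q. Y i \<omega> \<in> A i} \<in> sigma_sets (space Q) ?G" if "i \<in> {..<n}" for i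
    proof (rule sigma_sets.Basic)
      have "{\<omega> \<in> space Q. Y i \<omega> \<in> A i} = Y i -` A i \<inter> space Q" by blast
      then show "{\<omega> \<in> space Q. Y i \<omega> \<in> A i} \<in> ?G" using that A by blast
    qed
    then have "{\<omega> \<in> space Q. \<forall>i\<in>{..<n}. Y i \<omega> \<in> A i} \<in> sigma_sets (space Q) ?G"
      by (rule S.sets_Collect_finite_All) simp_all
    moreover have "b = {\<omega> \<in> space Q. \<forall>i\<in>{..<n}. Y i \<omega> \<in> A i}" unfolding b by blast
    ultimately show "b \<in> sigma_sets (space Q) ?G" by (simp only:)
  qed
  then show ?thesis
    unfolding gen_filtration_def by (subst sets_measure_of) auto
qed

lemma subalgebra_gen_filtration:
  assumes "\<And>n. Y n \<in> measurable Q E"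
  shows "subalgebra Q (gen_filtration Q E Y n)"
proof -
  have "sets (gen_filtration Q E Y n) \<subseteq> sets Q"
    unfolding gen_filtration_def using measurable_sets[OF assms]
    by (subst sets_measure_of) (auto intro!: sets.sigma_sets_subset)
  then show ?thesis by (simp add: subalgebra_def)
qed

text \<open>Integrating the conditional expectations of an indicator over a cylinder of the past
  gives the identities on the right. Conversely, these pass from cylinders to the whole past
  sigma-field by uniqueness of measures, and from indicators to bounded \<open>f\<close> by
  comparing image measures. Every later argument about c.i.d. goes through this form.\<close>

lemma cid_iff:
  fixes Y :: "nat \<Rightarrow> 'a \<Rightarrow> 'b"
  assumes "prob_space Q" and Y [measurable]: "\<And>n. Y n \<in> measurable Q E"
  shows "cid Q E Y \<longleftrightarrow> (\<forall>n k A B. n \<le> k \<longrightarrow> (\<forall>i. A i \<in> sets E) \<longrightarrow> B \<in> sets E \<longrightarrow>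
    measure Q {\<omega> \<in> space Q. (\<forall>i<n. Y i \<omega> \<in> A i) \<and> Y k \<omega> \<in> B}
    = measure Q {\<omega> \<in> space Q. (\<forall>i<n. Y i \<omega> \<in> A i) \<and> Y n \<omega> \<in> B})" (is "_ \<longleftrightarrow> ?R")
proof -
  interpret Q: prob_space Q by fact
  have fms: "finite_measure_subalgebra Q (gen_filtration Q E Y n)" for n
    using subalgebra_gen_filtration[OF Y] by unfold_locales
  have cyl: "{\<omega> \<in> space Q. \<forall>i<n. Y i \<omega> \<in> A i} \<in> sets (gen_filtration Q E Y n)"
    if "\<forall>i. A i \<in> sets E" for n A
    unfolding sets_gen_filtration_cylinders[OF Y] using that by (intro sigma_sets.Basic) auto
  show ?thesis
  proof (intro iffI allI impI)
    fix n k :: nat and A :: "nat \<Rightarrow> 'b set" and B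
    assume cid: "cid Q E Y" and "n \<le> (k::nat)" and A: "\<forall>i. A i \<in> sets E" and B [measurable]: "B \<in> sets E"
    interpret S: finite_measure_subalgebra Q "gen_filtration Q E Y n" by (rule fms)
    let ?C = "{\<omega> \<in> space Q. \<forall>i<n. Y i \<omega> \<in> A i}"
    let ?c = "\<lambda>k. real_cond_exp Q (gen_filtration Q E Y n) (\<lambda>\<omega>. indicator B (Y k \<omega>) :: real)"
    have C: "?C \<in> sets Q"
      by (rule subsetD[OF _ cyl[OF A]])
        (use subalgebra_gen_filtration[OF Y] in \<open>simp add: subalgebra_def\<close>)
    have "bounded ((indicator B :: _ \<Rightarrow> real) ` space E)"
      by (rule boundedI[of _ 1]) (auto simp: indicator_def)
    then have AE: "AE \<omega> in Q. ?c k \<omega> = ?c n \<omega>"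
      using B by (intro cid[unfolded cid_def, rule_format, OF \<open>n \<le> k\<close>]) auto
    have m: "measure Q {\<omega> \<in> space Q. (\<forall>i<n. Y i \<omega> \<in> A i) \<and> Y j \<omega> \<in> B} = (\<integral>\<omega>\<in>?C. ?c j \<omega> \<partial>Q)" for j
    proof -
      have int: "integrable Q (\<lambda>\<omega>. indicator B (Y j \<omega>) :: real)"
        by (rule Q.integrable_const_bound[of _ 1]) (auto simp: indicator_def)
      let ?D = "{\<omega> \<in> space Q. (\<forall>i<n. Y i \<omega> \<in> A i) \<and> Y j \<omega> \<in> B}"
      have "measure Q ?D = (\<integral>\<omega>. indicator ?D \<omega> \<partial>Q)"
        unfolding Bochner_Integration.integral_indicator by (rule arg_cong[where f="measure Q"]) blast
      also have "\<dots> = (\<integral>\<omega>\<in>?C. indicator B (Y j \<omega>) \<partial>Q)"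
        unfolding set_lebesgue_integral_def
        by (rule Bochner_Integration.integral_cong) (auto simp: indicator_def)
      also have "\<dots> = (\<integral>\<omega>\<in>?C. ?c j \<omega> \<partial>Q)"
        by (rule S.real_cond_exp_intA[OF int cyl[OF A]])
      finally show ?thesis .
    qed
    show "measure Q {\<omega> \<in> space Q. (\<forall>i<n. Y i \<omega> \<in> A i) \<and> Y k \<omega> \<in> B}
      = measure Q {\<omega> \<in> space Q. (\<forall>i<n. Y i \<omega> \<in> A i) \<and> Y n \<omega> \<in> B}"
      unfolding m set_lebesgue_integral_def
    proof (rule integral_cong_AE)
      have meas: "(\<lambda>\<omega>. indicator ?C \<omega> *\<^sub>R ?c j \<omega>) \<in> borel_measurable Q" for j
        by (intro borel_measurable_scaleR borel_measurable_indicator[OF C] borel_measurable_cond_exp2)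
      show "(\<lambda>\<omega>. indicator ?C \<omega> *\<^sub>R ?c k \<omega>) \<in> borel_measurable Q"
        "(\<lambda>\<omega>. indicator ?C \<omega> *\<^sub>R ?c n \<omega>) \<in> borel_measurable Q"
        by (rule meas)+
      show "AE \<omega> in Q. indicator ?C \<omega> *\<^sub>R ?c k \<omega> = indicator ?C \<omega> *\<^sub>R ?c n \<omega>"
        using AE by (rule eventually_mono) simp
    qed
  next
    assume R: ?R
    show "cid Q E Y"
      unfolding cid_def
    proof (intro allI impI)
      fix n k :: nat and f :: "'b \<Rightarrow> real"
      assume nk: "n \<le> k" and f [measurable]: "f \<in> borel_measurable E" and bd: "bounded (f ` space E)"
      interpret S: finite_measure_subalgebra Q "gen_filtration Q E Y n" by (rule fms)
      let ?G = "gen_filtration Q E Y n"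
      let ?P = "{{\<omega> \<in> space Q. \<forall>i<n. Y i \<omega> \<in> A i} | A. \<forall>i. A i \<in> sets E}"
      have G: "sets ?G \<subseteq> sets Q"
        using subalgebra_gen_filtration[of Y Q E n, OF Y] by (simp add: subalgebra_def)
      have idG: "id \<in> measurable Q ?G"
        by (rule measurable_from_subalg[OF subalgebra_gen_filtration[OF Y] measurable_ident])
      have eq1: "emeasure Q (C \<inter> (Y k -` B \<inter> space Q)) = emeasure Q (C \<inter> (Y n -` B \<inter> space Q))"
        if C: "C \<in> sets ?G" and B [measurable]: "B \<in> sets E" for C B
      proof -
        \<comment> \<open>The measure assigning to a past event \<open>C\<close> the mass of
          \<open>C\<close> intersected with \<open>Y j\<close> in \<open>B\<close>; the image under
          \<open>id\<close> restricts it to the past sigma-field, where cylinders generate.\<close>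
        let ?M = "\<lambda>j. distr (density Q (indicator (Y j -` B \<inter> space Q))) ?G id"
        have em: "emeasure (?M j) C = emeasure Q (C \<inter> (Y j -` B \<inter> space Q))"
          if "C \<in> sets ?G" for C j
        proof -
          have "C \<in> sets Q" "id -` C \<inter> space Q = C"
            using that G sets.sets_into_space[OF that] by auto
          then show ?thesis
            using that idG by (simp add: emeasure_distr emeasure_restricted Int_commute)
        qed
        have "?M k = ?M n"
        proof (rule measure_eqI_generator_eq)
          show "Int_stable ?P"
          proof (rule Int_stableI)
            fix a b assume "a \<in> ?P" "b \<in> ?P"
            then obtain A A' where *: "a = {\<omega> \<in> space Q. \<forall>i<n. Y i \<omega> \<in> A i}" "\<forall>i. A i \<in> sets E"
              "b = {\<omega> \<in> space Q. \<forall>i<n. Y i \<omega> \<in> A' i}" "\<forall>i. A' i \<in> sets E" by blast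
            then show "a \<inter> b \<in> ?P"
              by (intro CollectI exI[where x="\<lambda>i. A i \<inter> A' i"]) auto
          qed
          show "?P \<subseteq> Pow (space Q)" by auto
          show "sets (?M k) = sigma_sets (space Q) ?P" "sets (?M n) = sigma_sets (space Q) ?P"
            by (simp_all add: sets_gen_filtration_cylinders[OF Y])
          have sp: "space Q \<in> ?P"
            using measurable_space[OF Y]
            by (intro CollectI exI[where x="\<lambda>i. space E"]) auto
          show "range (\<lambda>i::nat. space Q) \<subseteq> ?P" using sp by auto
          show "(\<Union>i::nat. space Q) = space Q" by simp
          show "emeasure (?M k) (space Q) \<noteq> \<infinity>"
            using sets.top[of ?G] by (subst em) auto
          fix a assume "a \<in> ?P"
          then obtain A where a: "a = {\<omega> \<in> space Q. \<forall>i<n. Y i \<omega> \<in> A i}" and A: "\<forall>i. A i \<in> sets E"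
            by (elim CollectE exE conjE) (rule that)
          have "a \<in> sets ?G" unfolding a by (rule cyl[OF A])
          moreover have "a \<inter> (Y j -` B \<inter> space Q)
              = {\<omega> \<in> space Q. (\<forall>i<n. Y i \<omega> \<in> A i) \<and> Y j \<omega> \<in> B}" for j
            by (auto simp: a)
          moreover note R[rule_format, OF nk A[rule_format] B]
          ultimately show "emeasure (?M k) a = emeasure (?M n) a"
            by (simp only: em Q.emeasure_eq_measure)
        qed
        then show ?thesis using em[OF C] by metis
      qed
      have integ: "(\<integral>\<omega>\<in>C. f (Y k \<omega>) \<partial>Q) = (\<integral>\<omega>\<in>C. f (Y n \<omega>) \<partial>Q)" if C: "C \<in> sets ?G" for C
      proof -
        have [measurable]: "C \<in> sets Q" using C G by auto
        \<comment> \<open>The law of \<open>Y j\<close> restricted to the fixed past event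
          \<open>C\<close>. By \<open>eq1\<close> it is the same for \<open>k\<close> and
          \<open>n\<close>, so integrals of any \<open>f\<close> agree without approximation by
          simple functions.\<close>
        let ?N = "\<lambda>j. distr (density Q (indicator C)) E (Y j)"
        have em: "emeasure (?N j) B = emeasure Q (C \<inter> (Y j -` B \<inter> space Q))" if "B \<in> sets E" for B j
          using that by (simp add: emeasure_distr emeasure_restricted)
        have "?N k = ?N n"
          by (rule measure_eqI) (simp_all add: em eq1 C)
        moreover have "(\<integral>\<omega>\<in>C. f (Y j \<omega>) \<partial>Q) = (\<integral>x. f x \<partial>?N j)" for j
        proof -
          have "(indicator C :: 'a \<Rightarrow> ennreal) = (\<lambda>x. ennreal (indicator C x))"
            by (simp add: fun_eq_iff ennreal_indicator)
          then show ?thesis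
            by (simp add: integral_distr integral_density set_lebesgue_integral_def)
        qed
        ultimately show ?thesis by metis
      qed
      obtain K where K: "\<And>x. x \<in> space E \<Longrightarrow> \<bar>f x\<bar> \<le> K"
        using bd by (auto simp: bounded_iff)
      have int: "integrable Q (\<lambda>\<omega>. f (Y j \<omega>))" for j
        using K measurable_space[OF Y] by (intro Q.integrable_const_bound[of _ K]) auto
      \<comment> \<open>The conditional expectation of \<open>f (Y n)\<close> integrates over every
        past event to the same value as \<open>f (Y k)\<close>, hence it is a version of the
        conditional expectation of \<open>f (Y k)\<close>.\<close>
      show "AE \<omega> in Q. real_cond_exp Q ?G (\<lambda>\<omega>. f (Y k \<omega>)) \<omega> = real_cond_exp Q ?G (\<lambda>\<omega>. f (Y n \<omega>)) \<omega>"
        using integ S.real_cond_exp_intA[OF int] int S.real_cond_exp_int(1)[OF int]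
        by (intro S.real_cond_exp_charact) auto
    qed
  qed
qed

subsection \<open>Exchangeability and permuted sequences\<close>

lemma measurable_seq_space [measurable]:
  assumes "\<And>n. Y n \<in> measurable Q E"
  shows "(\<lambda>\<omega> n. Y n \<omega>) \<in> measurable Q (seq_space E)"
  unfolding seq_space_def using assms by (intro measurable_PiM_single') (auto dest: measurable_space)

text \<open>Finite-dimensional boxes determine a law on the product, and a box over a finite set
  \<open>J\<close> of indices becomes one over an initial segment by imposing \<open>space E\<close>
  at the missing indices.\<close>

lemma distr_seq_space_eqI:
  assumes "prob_space Q" and Y: "\<And>n. Y n \<in> measurable Q E" and Y': "\<And>n. Y' n \<in> measurable Q E"
    and eq: "\<And>N A. (\<And>i. A i \<in> sets E) \<Longrightarrow> measure Q {\<omega> \<in> space Q. \<forall>i<N. Y i \<omega> \<in> A i}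
      = measure Q {\<omega> \<in> space Q. \<forall>i<N. Y' i \<omega> \<in> A i}"
  shows "distr Q (seq_space E) (\<lambda>\<omega> n. Y n \<omega>) = distr Q (seq_space E) (\<lambda>\<omega> n. Y' n \<omega>)"
proof -
  interpret Q: prob_space Q by fact
  note m = measurable_seq_space[of _ Q E, OF Y] measurable_seq_space[of _ Q E, OF Y']
  show ?thesis
  proof (rule measure_eqI_PiM_infinite[where I=UNIV and M="\<lambda>_. E"])
    show "sets (distr Q (seq_space E) (\<lambda>\<omega> n. Y n \<omega>)) = sets (Pi\<^sub>M UNIV (\<lambda>_. E))"
      "sets (distr Q (seq_space E) (\<lambda>\<omega> n. Y' n \<omega>)) = sets (Pi\<^sub>M UNIV (\<lambda>_. E))"
      by (simp_all add: seq_space_def)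
    show "finite_measure (distr Q (seq_space E) (\<lambda>\<omega> n. Y n \<omega>))"
      by (rule Q.finite_measure_distr[OF m(1)])
    fix A and J :: "nat set"
    assume J: "finite J" and A: "\<And>i. i \<in> J \<Longrightarrow> A i \<in> sets E"
    obtain N where N: "J \<subseteq> {..<N}"
      using J finite_nat_iff_bounded by blast
    let ?A = "\<lambda>i. if i \<in> J then A i else space E"
    have B: "prod_emb UNIV (\<lambda>_. E) J (Pi\<^sub>E J A) \<in> sets (seq_space E)"
      unfolding seq_space_def using J A by (intro sets_PiM_I) auto
    have *: "(\<lambda>\<omega> n. Z n \<omega>) -` prod_emb UNIV (\<lambda>_. E) J (Pi\<^sub>E J A) \<inter> space Q
        = {\<omega> \<in> space Q. \<forall>i<N. Z i \<omega> \<in> ?A i}" if Z: "\<And>n. Z n \<in> measurable Q E" for Z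
      using N measurable_space[OF Z] A
      by (auto simp: prod_emb_def space_PiM PiE_iff split: if_splits) blast+
    have "measure Q {\<omega> \<in> space Q. \<forall>i<N. Y i \<omega> \<in> ?A i} = measure Q {\<omega> \<in> space Q. \<forall>i<N. Y' i \<omega> \<in> ?A i}"
      using A by (intro eq) auto
    then show "emeasure (distr Q (seq_space E) (\<lambda>\<omega> n. Y n \<omega>)) (prod_emb UNIV (\<lambda>_. E) J (Pi\<^sub>E J A))
      = emeasure (distr Q (seq_space E) (\<lambda>\<omega> n. Y' n \<omega>)) (prod_emb UNIV (\<lambda>_. E) J (Pi\<^sub>E J A))"
      by (simp add: emeasure_distr[OF m(1) B] emeasure_distr[OF m(2) B] *[OF Y] *[OF Y'] Q.emeasure_eq_measure)
  qed
qed

lemma exchangeable_prob_eq: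
  assumes X: "\<And>n. X n \<in> measurable P E" and "exchangeable P E X" "finite_permutation \<tau>"
    "C \<in> sets (seq_space E)"
  shows "measure P {\<omega> \<in> space P. (\<lambda>n. X (\<tau> n) \<omega>) \<in> C} = measure P {\<omega> \<in> space P. (\<lambda>n. X n \<omega>) \<in> C}"
proof -
  have "measure (distr P (seq_space E) (\<lambda>\<omega> n. X (\<tau> n) \<omega>)) C
    = measure (distr P (seq_space E) (\<lambda>\<omega> n. X n \<omega>)) C"
    using assms unfolding exchangeable_def by simp
  then show ?thesis
    using assms(4) by (simp add: measure_distr measurable_seq_space X vimage_def Int_def conj_commute)
qed

section \<open>Finite permutations and their action on shift-invariant sets\<close>

lemma finite_permutation_transpose: "finite_permutation (Transposition.transpose n k)"
proof -
  have "{i. Transposition.transpose n k i \<noteq> i} \<subseteq> {n, k}"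
    by (auto simp: Transposition.transpose_def)
  then show ?thesis
    unfolding finite_permutation_def by (auto intro: finite_subset)
qed

lemma finite_permutation_comp:
  assumes "finite_permutation \<sigma>" "finite_permutation \<tau>"
  shows "finite_permutation (\<sigma> \<circ> \<tau>)"
proof -
  have "{i. (\<sigma> \<circ> \<tau>) i \<noteq> i} \<subseteq> {i. \<tau> i \<noteq> i} \<union> {i. \<sigma> i \<noteq> i}" by auto
  then show ?thesis
    using assms unfolding finite_permutation_def by (auto intro: bij_comp finite_subset)
qed

text \<open>Induction on \<open>m\<close>: if \<tau> agrees with \<open>e\<close> below
  \<open>m\<close>, follow it by the transposition of \<open>\<tau> m\<close> and
  \<open>e m\<close>. Earlier values avoid both points because \<open>e\<close> and \<tau> are
  injective. Thus a hypothesis on finite permutations applies to any finite list of distinct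
  indices.\<close>

lemma finite_permutation_extends:
  fixes e :: "nat \<Rightarrow> nat"
  assumes "inj_on e {..<m}"
  obtains \<tau> where "finite_permutation \<tau>" "\<And>i. i < m \<Longrightarrow> \<tau> i = e i"
proof -
  have "\<exists>\<tau>. finite_permutation \<tau> \<and> (\<forall>i<m. \<tau> i = e i)"
    using assms
  proof (induction m)
    case 0
    show ?case by (intro exI[of _ id]) (simp add: finite_permutation_def bij_id[unfolded id_def])
  next
    case (Suc m)
    then obtain \<tau> where \<tau>: "finite_permutation \<tau>" "\<forall>i<m. \<tau> i = e i"
      by (auto simp: inj_on_def)
    define \<sigma> where "\<sigma> = Transposition.transpose (\<tau> m) (e m) \<circ> \<tau>"
    have inj: "inj \<tau>" using \<tau>(1) by (simp add: finite_permutation_def bij_is_inj)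
    have "\<sigma> i = e i" if "i < Suc m" for i
    proof (cases "i = m")
      case False
      then have "i < m" using that by simp
      then have "\<tau> i = e i" "e i \<noteq> e m" "\<tau> i \<noteq> \<tau> m"
        using \<tau>(2) False inj_onD[OF Suc.prems, of i m] injD[OF inj, of i m] that by auto
      then show ?thesis by (simp add: \<sigma>_def Transposition.transpose_def)
    qed (simp add: \<sigma>_def)
    then show ?case
      using finite_permutation_comp[OF finite_permutation_transpose \<tau>(1)] unfolding \<sigma>_def by blast
  qed
  with that show thesis by blast
qed

text \<open>Shifting \<open>m\<close> times does not affect membership in \<open>B\<close>, so only
  the tail of the path matters, and beyond some \<open>m\<close> the permutation leaves the tail
  unchanged.\<close>

lemma shift_invariant_permute:
  assumes B: "B \<in> sets (seq_space E)" "seq_shift -` B \<inter> space (seq_space E) = B"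
    and \<tau>: "finite_permutation \<tau>" and x: "x \<in> space (seq_space E)"
  shows "(\<lambda>n. x (\<tau> n)) \<in> B \<longleftrightarrow> x \<in> B"
proof -
  have sp: "x \<in> space (seq_space E) \<longleftrightarrow> (\<forall>n. x n \<in> space E)" for x
    by (auto simp: seq_space_def space_PiM)
  have step: "x \<in> B \<longleftrightarrow> seq_shift x \<in> B" if "x \<in> space (seq_space E)" for x
    using B(2) that by blast
  have *: "x \<in> B \<longleftrightarrow> (\<lambda>n. x (n + m)) \<in> B" if "x \<in> space (seq_space E)" for x m
  proof (induction m)
    case (Suc m)
    have "(\<lambda>n. x (n + m)) \<in> space (seq_space E)" using that by (simp add: sp)
    then show ?case using Suc step[of "\<lambda>n. x (n + m)"] by (simp add: seq_shift_def)
  qed simp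
  obtain m where "{n. \<tau> n \<noteq> n} \<subseteq> {..<m}"
    using \<tau> finite_nat_iff_bounded unfolding finite_permutation_def by blast
  then have "\<tau> (n + m) = n + m" for n by fastforce
  moreover have "(\<lambda>n. x (\<tau> n)) \<in> space (seq_space E)" using x by (simp add: sp)
  ultimately show ?thesis using *[OF x, of m] *[of "\<lambda>n. x (\<tau> n)" m] by simp
qed

lemma sets_seq_space_Collect:
  assumes "\<And>i. A i \<in> sets E" "B \<in> sets E"
  shows "{x \<in> space (seq_space E). (\<forall>i<n. x i \<in> A i) \<and> x k \<in> B} \<in> sets (seq_space E)"
proof -
  have [measurable]: "(\<lambda>x. x i) \<in> measurable (seq_space E) E" for i
    unfolding seq_space_def by simp
  note assms [measurable]
  show ?thesis by measurable
qed

section \<open>From exchangeability to the two c.i.d. statements\<close>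

text \<open>Transposing \<open>n\<close> and \<open>k\<close> before applying \<tau> puts
  \<open>X (\<tau> k)\<close> at position \<open>n\<close> and keeps the earlier positions, since
  \<open>n \<le> k\<close>. Both rearrangements have the law of \<open>X\<close>.\<close>

lemma exchangeable_imp_cid_permute:
  fixes X :: "nat \<Rightarrow> 'a \<Rightarrow> 'b"
  assumes "prob_space P" and X: "\<And>n. X n \<in> measurable P E"
    and ex: "exchangeable P E X" and \<tau>: "finite_permutation \<tau>"
  shows "cid P E (\<lambda>n. X (\<tau> n))"
  unfolding cid_iff[of P "\<lambda>n. X (\<tau> n)", OF \<open>prob_space P\<close> X]
proof (intro allI impI)
  fix n k :: nat and A :: "nat \<Rightarrow> 'b set" and B
  assume *: "n \<le> k" "\<forall>i. A i \<in> sets E" "B \<in> sets E"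
  define \<sigma> where "\<sigma> = \<tau> \<circ> Transposition.transpose n k"
  have fp: "finite_permutation \<sigma>"
    unfolding \<sigma>_def by (rule finite_permutation_comp[OF \<tau> finite_permutation_transpose])
  let ?C = "{x \<in> space (seq_space E). (\<forall>i<n. x i \<in> A i) \<and> x n \<in> B}"
  have sp: "(\<lambda>n. X (\<rho> n) \<omega>) \<in> space (seq_space E)" if "\<omega> \<in> space P" for \<rho> \<omega>
    using measurable_space[OF X that] by (auto simp: seq_space_def space_PiM)
  have \<sigma>: "\<sigma> n = \<tau> k" "\<And>i. i < n \<Longrightarrow> \<sigma> i = \<tau> i"
    using * by (auto simp: \<sigma>_def Transposition.transpose_def)
  have C: "?C \<in> sets (seq_space E)" using * by (intro sets_seq_space_Collect) auto
  have "measure P {\<omega> \<in> space P. (\<lambda>n. X (\<sigma> n) \<omega>) \<in> ?C} = measure P {\<omega> \<in> space P. (\<lambda>n. X (\<tau> n) \<omega>) \<in> ?C}"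
    unfolding exchangeable_prob_eq[OF X ex fp C] exchangeable_prob_eq[OF X ex \<tau> C] ..
  moreover have "{\<omega> \<in> space P. (\<lambda>n. X (\<sigma> n) \<omega>) \<in> ?C}
    = {\<omega> \<in> space P. (\<forall>i<n. X (\<tau> i) \<omega> \<in> A i) \<and> X (\<tau> k) \<omega> \<in> B}"
    by (rule Collect_cong) (auto simp: sp \<sigma>)
  moreover have "{\<omega> \<in> space P. (\<lambda>n. X (\<tau> n) \<omega>) \<in> ?C}
    = {\<omega> \<in> space P. (\<forall>i<n. X (\<tau> i) \<omega> \<in> A i) \<and> X (\<tau> n) \<omega> \<in> B}"
    by (rule Collect_cong) (auto simp: sp)
  ultimately show "measure P {\<omega> \<in> space P. (\<forall>i<n. X (\<tau> i) \<omega> \<in> A i) \<and> X (\<tau> k) \<omega> \<in> B}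
    = measure P {\<omega> \<in> space P. (\<forall>i<n. X (\<tau> i) \<omega> \<in> A i) \<and> X (\<tau> n) \<omega> \<in> B}" by simp
qed

text \<open>The factor \<open>1 / measure P H\<close> cancels from the identities of
  \<open>cid_iff\<close>. What remains are intersections with \<open>H\<close>, which also make
  sense for null \<open>H\<close>.\<close>

lemma cid_uniform_measure_iff:
  assumes "prob_space P" and X [measurable]: "\<And>n. X n \<in> measurable P E"
    and H [measurable]: "H \<in> sets P" and pos: "measure P H > 0"
  shows "cid (uniform_measure P H) E X \<longleftrightarrow>
    (\<forall>n k A B. n \<le> k \<longrightarrow> (\<forall>i. A i \<in> sets E) \<longrightarrow> B \<in> sets E \<longrightarrow>
      measure P {\<omega> \<in> H. (\<forall>i<n. X i \<omega> \<in> A i) \<and> X k \<omega> \<in> B}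
      = measure P {\<omega> \<in> H. (\<forall>i<n. X i \<omega> \<in> A i) \<and> X n \<omega> \<in> B})"
proof -
  interpret prob_space P by fact
  have "prob_space (uniform_measure P H)"
    using pos by (intro prob_space_uniform_measure) (auto simp: emeasure_eq_measure)
  moreover have "X n \<in> measurable (uniform_measure P H) E" for n
    by simp
  moreover have "measure (uniform_measure P H) {\<omega> \<in> space P. (\<forall>i<n. X i \<omega> \<in> A i) \<and> X k \<omega> \<in> B}
      = measure P {\<omega> \<in> H. (\<forall>i<n. X i \<omega> \<in> A i) \<and> X k \<omega> \<in> B} / measure P H"
    if "\<forall>i. A i \<in> sets E" and [measurable]: "B \<in> sets E" for n k A B
  proof -
    have [measurable]: "A i \<in> sets E" for i using that by simp
    have "H \<inter> {\<omega> \<in> space P. (\<forall>i<n. X i \<omega> \<in> A i) \<and> X k \<omega> \<in> B}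
      = {\<omega> \<in> H. (\<forall>i<n. X i \<omega> \<in> A i) \<and> X k \<omega> \<in> B}"
      using sets.sets_into_space[OF H] by auto
    then show ?thesis using pos by (simp add: emeasure_eq_measure)
  qed
  ultimately show ?thesis
    using pos by (simp add: cid_iff)
qed

text \<open>The transposition of \<open>n\<close> and \<open>k\<close> works again: by
  \<open>shift_invariant_permute\<close> it leaves the event \<open>H\<close> as it is, so
  \<open>H\<close> can be carried along in the path event.\<close>

lemma exchangeable_imp_cid_uniform_measure:
  fixes X :: "nat \<Rightarrow> 'a \<Rightarrow> 'b"
  assumes P: "prob_space P" and X: "\<And>n. X n \<in> measurable P E"
    and ex: "exchangeable P E X" and H: "H \<in> shift_invariant_sets P E X" and pos: "measure P H > 0"
  shows "cid (uniform_measure P H) E X"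
proof -
  obtain B0 where B0: "B0 \<in> sets (seq_space E)" "seq_shift -` B0 \<inter> space (seq_space E) = B0"
    and H_eq: "H = {\<omega> \<in> space P. (\<lambda>n. X n \<omega>) \<in> B0}"
    using H unfolding shift_invariant_sets_def by blast
  have "H = (\<lambda>\<omega> n. X n \<omega>) -` B0 \<inter> space P" by (auto simp: H_eq)
  then have "H \<in> sets P"
    using measurable_sets[OF measurable_seq_space[OF X] B0(1)] by simp
  show ?thesis
    unfolding cid_uniform_measure_iff[OF P X \<open>H \<in> sets P\<close> pos]
  proof (intro allI impI)
    fix n k :: nat and A :: "nat \<Rightarrow> 'b set" and B
    assume *: "n \<le> k" "\<forall>i. A i \<in> sets E" "B \<in> sets E"
    define \<sigma> where "\<sigma> = Transposition.transpose n k"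
    have fp: "finite_permutation \<sigma>" unfolding \<sigma>_def by (rule finite_permutation_transpose)
    let ?C = "B0 \<inter> {x \<in> space (seq_space E). (\<forall>i<n. x i \<in> A i) \<and> x n \<in> B}"
    have sp: "(\<lambda>n. X n \<omega>) \<in> space (seq_space E)" "(\<lambda>n. X (\<sigma> n) \<omega>) \<in> space (seq_space E)"
      if "\<omega> \<in> space P" for \<omega>
      using measurable_space[OF X that] by (auto simp: seq_space_def space_PiM)
    have \<sigma>: "\<sigma> n = k" "\<And>i. i < n \<Longrightarrow> \<sigma> i = i"
      using * by (auto simp: \<sigma>_def Transposition.transpose_def)
    have C: "?C \<in> sets (seq_space E)"
      using * B0 by (intro sets.Int sets_seq_space_Collect) auto
    have "measure P {\<omega> \<in> space P. (\<lambda>n. X (\<sigma> n) \<omega>) \<in> ?C} = measure P {\<omega> \<in> space P. (\<lambda>n. X n \<omega>) \<in> ?C}"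
      by (rule exchangeable_prob_eq[OF X ex fp C])
    moreover have "{\<omega> \<in> space P. (\<lambda>n. X (\<sigma> n) \<omega>) \<in> ?C} = {\<omega> \<in> H. (\<forall>i<n. X i \<omega> \<in> A i) \<and> X k \<omega> \<in> B}"
      using \<sigma> sp shift_invariant_permute[OF B0 fp] by (auto simp: H_eq)
    moreover have "{\<omega> \<in> space P. (\<lambda>n. X n \<omega>) \<in> ?C} = {\<omega> \<in> H. (\<forall>i<n. X i \<omega> \<in> A i) \<and> X n \<omega> \<in> B}"
      using sp by (auto simp: H_eq)
    ultimately show "measure P {\<omega> \<in> H. (\<forall>i<n. X i \<omega> \<in> A i) \<and> X k \<omega> \<in> B}
      = measure P {\<omega> \<in> H. (\<forall>i<n. X i \<omega> \<in> A i) \<and> X n \<omega> \<in> B}" by simp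
  qed
qed

section \<open>From c.i.d. permuted sequences to exchangeability\<close>

lemma cid_permute_imp_replace:
  assumes P: "prob_space P" and X: "\<And>n. X n \<in> measurable P E"
    and cid: "\<And>\<tau>. finite_permutation \<tau> \<Longrightarrow> cid P E (\<lambda>n. X (\<tau> n))"
    and J: "finite J" "inj_on a J" "u \<notin> a ` J" "v \<notin> a ` J"
    and A: "\<And>i. A i \<in> sets E" and B: "B \<in> sets E"
  shows "measure P {\<omega> \<in> space P. (\<forall>i\<in>J. X (a i) \<omega> \<in> A i) \<and> X u \<omega> \<in> B}
    = measure P {\<omega> \<in> space P. (\<forall>i\<in>J. X (a i) \<omega> \<in> A i) \<and> X v \<omega> \<in> B}"
proof (cases "u = v")
  case False
  obtain e where e: "bij_betw e {..<card J} J"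
    using J(1) bij_betw_from_nat_into_finite by blast
  let ?n = "card J"
  define b where "b i = (if i < ?n then a (e i) else if i = ?n then u else v)" for i
  have ae: "inj_on (a \<circ> e) {..<?n}" "(a \<circ> e) ` {..<?n} = a ` J"
    using e J(2) unfolding image_comp[symmetric] by (auto simp: bij_betw_def intro!: comp_inj_on)
  have "inj_on b {..<?n}"
    using ae(1) by (auto simp: inj_on_def b_def)
  moreover have "b ` {..<?n} = a ` J"
    using ae(2) by (auto simp: b_def image_iff)
  moreover have "{..<Suc (Suc ?n)} = insert (Suc ?n) (insert ?n {..<?n})" by auto
  moreover have "b ?n = u" "b (Suc ?n) = v" by (auto simp: b_def)
  ultimately have "inj_on b {..<Suc (Suc ?n)}"
    using False J by (auto simp: inj_on_insert)
  then obtain \<tau> where \<tau>: "finite_permutation \<tau>" "\<And>i. i < Suc (Suc ?n) \<Longrightarrow> \<tau> i = b i"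
    using finite_permutation_extends by blast
  have *: "(\<forall>i<?n. X (\<tau> i) \<omega> \<in> A (e i)) \<longleftrightarrow> (\<forall>i\<in>J. X (a i) \<omega> \<in> A i)" for \<omega>
  proof -
    have "(\<forall>i<?n. X (\<tau> i) \<omega> \<in> A (e i)) \<longleftrightarrow> (\<forall>i\<in>{..<?n}. X (a (e i)) \<omega> \<in> A (e i))"
      by (auto simp: \<tau>(2) b_def)
    also have "\<dots> \<longleftrightarrow> (\<forall>i\<in>e ` {..<?n}. X (a i) \<omega> \<in> A i)" by blast
    also have "e ` {..<?n} = J" using e by (simp add: bij_betw_def)
    finally show ?thesis .
  qed
  have uv: "\<tau> ?n = u" "\<tau> (Suc ?n) = v" using \<tau>(2) by (auto simp: b_def)
  have "measure P {\<omega> \<in> space P. (\<forall>i<?n. X (\<tau> i) \<omega> \<in> A (e i)) \<and> X (\<tau> (Suc ?n)) \<omega> \<in> B}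
    = measure P {\<omega> \<in> space P. (\<forall>i<?n. X (\<tau> i) \<omega> \<in> A (e i)) \<and> X (\<tau> ?n) \<omega> \<in> B}"
    using cid[OF \<tau>(1)] A B unfolding cid_iff[of P "\<lambda>n. X (\<tau> n)", OF P X] by (meson le_SucI le_refl)
  then show ?thesis unfolding * uv by simp
qed simp

text \<open>The indices are moved to \<open>N, N + 1, ...\<close> one at a time; \<open>b k\<close>
  is the index map after \<open>k\<close> moves. As \<open>N\<close> exceeds all old indices, no
  move produces a collision, and the right-hand side no longer mentions \<open>a\<close>.\<close>

lemma cid_permute_imp_inj_eq:
  assumes P: "prob_space P" and X: "\<And>n. X n \<in> measurable P E"
    and cid: "\<And>\<tau>. finite_permutation \<tau> \<Longrightarrow> cid P E (\<lambda>n. X (\<tau> n))"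
    and a: "inj_on a {..<n}" "a ` {..<n} \<subseteq> {..<N}" and A: "\<And>i. A i \<in> sets E"
  shows "measure P {\<omega> \<in> space P. \<forall>i<n. X (a i) \<omega> \<in> A i}
    = measure P {\<omega> \<in> space P. \<forall>i<n. X (N + i) \<omega> \<in> A i}"
proof -
  define b where "b k i = (if i < k then N + i else a i)" for k i
  have "measure P {\<omega> \<in> space P. \<forall>i<n. X (a i) \<omega> \<in> A i}
      = measure P {\<omega> \<in> space P. \<forall>i<n. X (b k i) \<omega> \<in> A i}" if "k \<le> n" for k
    using that
  proof (induction k)
    case 0
    show ?case by (simp add: b_def)
  next
    case (Suc k)
    \<comment> \<open>\<open>b k\<close> and \<open>b (Suc k)\<close> agree on \<open>?J\<close>; at
      \<open>k\<close> they take the values \<open>a k\<close> and \<open>N + k\<close>, the two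
      indices to be exchanged.\<close>
    let ?J = "{..<n} - {k}"
    have a': "a i < N" if "i < n" for i using a(2) that by auto
    have "inj_on (b k) ?J"
      using a(1) a' by (auto simp: inj_on_def b_def) (metis not_add_less1)+
    moreover have "a k \<notin> b k ` ?J" "N + k \<notin> b k ` ?J"
      using a(1) a' Suc.prems by (auto simp: b_def inj_on_def split: if_splits)
        (metis not_add_less1 less_le_trans Suc_le_eq)+
    ultimately have "measure P {\<omega> \<in> space P. (\<forall>i\<in>?J. X (b k i) \<omega> \<in> A i) \<and> X (a k) \<omega> \<in> A k}
      = measure P {\<omega> \<in> space P. (\<forall>i\<in>?J. X (b k i) \<omega> \<in> A i) \<and> X (N + k) \<omega> \<in> A k}"
      using A by (intro cid_permute_imp_replace[OF P X cid]) auto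
    moreover have "(\<forall>i\<in>?J. X (b k i) \<omega> \<in> A i) \<and> X (a k) \<omega> \<in> A k \<longleftrightarrow> (\<forall>i<n. X (b k i) \<omega> \<in> A i)" for \<omega>
      using Suc.prems by (auto simp: b_def)
    moreover have "(\<forall>i\<in>?J. X (b k i) \<omega> \<in> A i) \<and> X (N + k) \<omega> \<in> A k \<longleftrightarrow> (\<forall>i<n. X (b (Suc k) i) \<omega> \<in> A i)" for \<omega>
      using Suc.prems by (auto simp: b_def less_Suc_eq)
    ultimately show ?case using Suc by simp
  qed
  from this[of n] show ?thesis by (simp add: b_def cong: conj_cong)
qed

text \<open>The marginals along \<tau> and along the identity both equal the marginal along
  \<open>M, M + 1, ...\<close>, once \<open>M\<close> exceeds the indices used by either.\<close>

lemma cid_permute_imp_exchangeable: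
  assumes P: "prob_space P" and X: "\<And>n. X n \<in> measurable P E"
    and cid: "\<And>\<tau>. finite_permutation \<tau> \<Longrightarrow> cid P E (\<lambda>n. X (\<tau> n))"
  shows "exchangeable P E X"
  unfolding exchangeable_def
proof (intro allI impI distr_seq_space_eqI[OF P X X])
  fix \<tau> N and A :: "nat \<Rightarrow> _ set"
  assume \<tau>: "finite_permutation \<tau>" and A: "\<And>i. A i \<in> sets E"
  have "inj_on \<tau> {..<N}"
    using \<tau> by (auto simp: finite_permutation_def bij_def intro: inj_on_subset)
  obtain M where M: "\<tau> ` {..<N} \<union> {..<N} \<subseteq> {..<M}"
    using finite_nat_iff_bounded[of "\<tau> ` {..<N} \<union> {..<N}"] by auto
  have "measure P {\<omega> \<in> space P. \<forall>i<N. X (\<tau> i) \<omega> \<in> A i}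
    = measure P {\<omega> \<in> space P. \<forall>i<N. X (M + i) \<omega> \<in> A i}"
    using M A \<open>inj_on \<tau> {..<N}\<close> by (intro cid_permute_imp_inj_eq[OF P X cid]) auto
  also have "\<dots> = measure P {\<omega> \<in> space P. \<forall>i<N. X (id i) \<omega> \<in> A i}"
    using M A by (intro cid_permute_imp_inj_eq[OF P X cid, symmetric]) auto
  finally show "measure P {\<omega> \<in> space P. \<forall>i<N. X (\<tau> i) \<omega> \<in> A i}
    = measure P {\<omega> \<in> space P. \<forall>i<N. X i \<omega> \<in> A i}" by simp
qed

subsection \<open>Block averages\<close>

text \<open>Expanding the square leaves averages of the Gram entries over \<open>I\<close> x
  \<open>I\<close>, \<open>J\<close> x \<open>J\<close> and \<open>I\<close> x \<open>J\<close>.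
  Diagonal entries are bounded by 1 only, which costs \<open>1 / card I\<close> and
  \<open>1 / card J\<close>. The lower bound \<open>l\<close> includes \<open>i = j\<close>, so the
  index sets may overlap.\<close>

lemma (in prob_space) second_moment_diff_averages:
  fixes Z :: "nat \<Rightarrow> 'a \<Rightarrow> real"
  assumes [measurable]: "\<And>k. Z k \<in> borel_measurable M" and Z: "\<And>k x. Z k x \<in> {0..1}"
    and I: "finite I" "I \<noteq> {}" and J: "finite J" "J \<noteq> {}"
    and u: "\<And>i j. i \<in> I \<Longrightarrow> j \<in> I \<Longrightarrow> i \<noteq> j \<Longrightarrow> expectation (\<lambda>x. Z i x * Z j x) \<le> u" "0 \<le> u"
    and v: "\<And>i j. i \<in> J \<Longrightarrow> j \<in> J \<Longrightarrow> i \<noteq> j \<Longrightarrow> expectation (\<lambda>x. Z i x * Z j x) \<le> v" "0 \<le> v"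
    and l: "\<And>i j. i \<in> I \<Longrightarrow> j \<in> J \<Longrightarrow> l \<le> expectation (\<lambda>x. Z i x * Z j x)"
  shows "expectation (\<lambda>x. ((\<Sum>i\<in>I. Z i x) / card I - (\<Sum>j\<in>J. Z j x) / card J)\<^sup>2)
    \<le> u + v - 2 * l + 1 / card I + 1 / card J"
proof -
  let ?g = "\<lambda>i j. expectation (\<lambda>x. Z i x * Z j x)"
  let ?G = "\<lambda>I J. \<Sum>i\<in>I. \<Sum>j\<in>J. ?g i j"
  have bd: "Z i x * Z j x \<in> {0..1}" for i j x
    using Z[of i x] Z[of j x] by (auto intro: mult_le_one)
  have int: "integrable M (\<lambda>x. Z i x * Z j x)" for i j
    using bd by (intro integrable_const_bound[of _ 1]) auto
  have g1: "?g i j \<le> 1" for i j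
  proof -
    have "?g i j \<le> expectation (\<lambda>x. 1)"
      using bd int by (intro integral_mono) auto
    then show ?thesis by (simp add: prob_space)
  qed
  have prod: "(\<Sum>i\<in>I. Z i x) * (\<Sum>j\<in>J. Z j x) = (\<Sum>i\<in>I. \<Sum>j\<in>J. Z i x * Z j x)" for I J x
    by (rule sum_product)
  have intG: "integrable M (\<lambda>x. (\<Sum>i\<in>I. Z i x) * (\<Sum>j\<in>J. Z j x))" for I J
    unfolding prod using int by auto
  have G: "expectation (\<lambda>x. (\<Sum>i\<in>I. Z i x) * (\<Sum>j\<in>J. Z j x)) = ?G I J" for I J
    unfolding prod using int by (simp add: integral_sum)
  have upper: "?G I I / (real (card I))\<^sup>2 \<le> u + 1 / card I"
    if "finite I" "I \<noteq> {}" "0 \<le> u" "\<And>i j. i \<in> I \<Longrightarrow> j \<in> I \<Longrightarrow> i \<noteq> j \<Longrightarrow> ?g i j \<le> u" for I u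
  proof -
    have "?G I I \<le> (\<Sum>i\<in>I. \<Sum>j\<in>I. u + (if i = j then 1 else 0))"
    proof (intro sum_mono)
      fix i j assume "i \<in> I" "j \<in> I"
      then show "?g i j \<le> u + (if i = j then 1 else 0)"
        using that g1[of i j] by (cases "i = j") auto
    qed
    also have "\<dots> = (real (card I))\<^sup>2 * u + card I"
      using that by (simp add: sum.distrib power2_eq_square algebra_simps)
    finally show ?thesis
      using that by (simp add: field_simps power2_eq_square card_gt_0_iff)
  qed
  have "(\<Sum>i\<in>I. \<Sum>j\<in>J. l) \<le> ?G I J"
    using l by (intro sum_mono) auto
  then have lower: "l \<le> ?G I J / (real (card I) * real (card J))"
    using I J by (simp add: field_simps card_gt_0_iff)
  have "(\<lambda>x. ((\<Sum>i\<in>I. Z i x) / card I - (\<Sum>j\<in>J. Z j x) / card J)\<^sup>2)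
      = (\<lambda>x. (\<Sum>i\<in>I. Z i x) * (\<Sum>i\<in>I. Z i x) / (real (card I))\<^sup>2
        + (\<Sum>i\<in>J. Z i x) * (\<Sum>i\<in>J. Z i x) / (real (card J))\<^sup>2
        - 2 * ((\<Sum>i\<in>I. Z i x) * (\<Sum>j\<in>J. Z j x) / (real (card I) * real (card J))))"
    by (simp add: fun_eq_iff power2_eq_square algebra_simps)
  then have "expectation (\<lambda>x. ((\<Sum>i\<in>I. Z i x) / card I - (\<Sum>j\<in>J. Z j x) / card J)\<^sup>2)
      = ?G I I / (real (card I))\<^sup>2 + ?G J J / (real (card J))\<^sup>2
        - 2 * (?G I J / (real (card I) * real (card J)))"
    using intG by (simp add: G)
  then show ?thesis
    using upper[OF I u(2,1)] upper[OF J v(2,1)] lower by linarith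
qed

text \<open>
  Average \<open>Z\<close> over a block of indices with \<open>c \<approx> b\<close> and over a later block with \<open>c \<approx> a\<close>: the second moment
  of the difference is about \<open>b + a - 2 b\<close>.
\<close>

lemma (in prob_space) Gram_cluster_points_le:
  fixes Z :: "nat \<Rightarrow> 'a \<Rightarrow> real"
  assumes meas: "\<And>k. Z k \<in> borel_measurable M" and Z: "\<And>k x. Z k x \<in> {0..1}"
    and c: "\<And>k l. k < l \<Longrightarrow> expectation (\<lambda>x. Z k x * Z l x) = c k" and c0: "\<And>k. 0 \<le> c k"
    and r: "strict_mono r" "(\<lambda>k. c (r k)) \<longlonglongrightarrow> b" and s: "strict_mono s" "(\<lambda>k. c (s k)) \<longlonglongrightarrow> a"
  shows "b \<le> a"
proof (rule field_le_epsilon)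
  fix e :: real assume "0 < e"
  \<comment> \<open>The Gram entries contribute \<open>a - b + 4 * d\<close> and the two reciprocal
    block sizes less than \<open>d\<close> each.\<close>
  define d where "d = e / 6"
  have d: "0 < d" using \<open>0 < e\<close> by (simp add: d_def)
  obtain n where n: "1 / real (Suc n) < d"
    using reals_Archimedean[OF d] by (auto simp: inverse_eq_divide)
  obtain N1 where N1: "\<And>k. k \<ge> N1 \<Longrightarrow> \<bar>c (r k) - b\<bar> < d"
    using LIMSEQ_D[OF r(2) d] by auto
  obtain N2 where N2: "\<And>k. k \<ge> N2 \<Longrightarrow> \<bar>c (s k) - a\<bar> < d"
    using LIMSEQ_D[OF s(2) d] by auto
  \<comment> \<open>The second block starts where \<open>c (s k)\<close> is close to
    \<open>a\<close> and lies entirely after the first block, because \<open>s k\<close> is at least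
    \<open>k\<close>. All mixed entries are then of the form \<open>c i\<close> with
    \<open>i\<close> in the first block.\<close>
  define L where "L = max N2 (r (N1 + Suc n))"
  let ?I = "r ` {N1..<N1 + Suc n}" and ?J = "s ` {L..<L + Suc n}"
  have card: "card ?I = Suc n" "card ?J = Suc n"
    using r(1) s(1) by (simp_all add: card_image strict_mono_imp_inj_on inj_on_subset)
  have lt: "i < j" if "i \<in> ?I" "j \<in> ?J" for i j
  proof -
    have "i < r (N1 + Suc n)" using that(1) r(1) by (auto simp: strict_mono_def)
    also have "\<dots> \<le> L" by (simp add: L_def)
    also have "L \<le> j" using that(2) seq_suble[OF s(1)] by (auto intro: order_trans)
    finally show ?thesis .
  qed
  have cI: "\<bar>c i - b\<bar> < d" if "i \<in> ?I" for i using that N1 by auto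
  have cJ: "\<bar>c j - a\<bar> < d" if "j \<in> ?J" for j using that N2 by (auto simp: L_def)
  have sym: "expectation (\<lambda>x. Z i x * Z j x) = c (min i j)" if "i \<noteq> j" for i j
    using c[of i j] c[of j i] that by (cases "i < j") (auto simp: min_def mult.commute)
  have "0 \<le> b" "0 \<le> a" using c0 r(2) s(2) by (auto intro: LIMSEQ_le_const)
  have "0 \<le> expectation (\<lambda>x. ((\<Sum>i\<in>?I. Z i x) / card ?I - (\<Sum>j\<in>?J. Z j x) / card ?J)\<^sup>2)"
    by simp
  also have "\<dots> \<le> (b + d) + (a + d) - 2 * (b - d) + 1 / card ?I + 1 / card ?J"
  proof (rule second_moment_diff_averages[OF meas Z])
    fix i j assume ij: "i \<in> ?I" "j \<in> ?I" "i \<noteq> j"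
    then have "min i j \<in> ?I" by (simp add: min_def)
    from cI[OF this] show "expectation (\<lambda>x. Z i x * Z j x) \<le> b + d"
      using sym[OF ij(3)] by simp
  next
    fix i j assume ij: "i \<in> ?J" "j \<in> ?J" "i \<noteq> j"
    then have "min i j \<in> ?J" by (simp add: min_def)
    from cJ[OF this] show "expectation (\<lambda>x. Z i x * Z j x) \<le> a + d"
      using sym[OF ij(3)] by simp
  next
    fix i j assume ij: "i \<in> ?I" "j \<in> ?J"
    show "b - d \<le> expectation (\<lambda>x. Z i x * Z j x)"
      using c[OF lt[OF ij]] cI[OF ij(1)] by simp
  qed (use \<open>0 \<le> b\<close> \<open>0 \<le> a\<close> d in auto)
  also have "\<dots> \<le> a - b + 6 * d"
    using n unfolding card by simp
  finally show "b \<le> a + e" by (simp add: d_def)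
qed

text \<open>\<open>Gram_cluster_points_le\<close>, applied in both directions, shows that any two
  cluster points of \<open>c\<close> coincide; in a compact interval this forces
  convergence.\<close>

lemma (in prob_space) Gram_convergent:
  fixes Z :: "nat \<Rightarrow> 'a \<Rightarrow> real"
  assumes meas: "\<And>k. Z k \<in> borel_measurable M" and Z: "\<And>k x. Z k x \<in> {0..1}"
    and c: "\<And>k l. k < l \<Longrightarrow> expectation (\<lambda>x. Z k x * Z l x) = c k"
    and c01: "\<And>k. c k \<in> {0..1}"
  shows "\<exists>b. c \<longlonglongrightarrow> b"
proof -
  have compact: "\<exists>l r. strict_mono r \<and> (\<lambda>k. f (r k)) \<longlonglongrightarrow> l" if "\<And>k. f k \<in> {0..1}" for f :: "nat \<Rightarrow> real"
  proof -
    have "seq_compact {0..1::real}" by (simp add: compact_imp_seq_compact)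
    then show ?thesis using that unfolding seq_compact_def o_def by blast
  qed
  obtain b r where r: "strict_mono r" "(\<lambda>k. c (r k)) \<longlonglongrightarrow> b"
    using compact[of c] c01 by blast
  have c0: "0 \<le> c k" for k using c01[of k] by simp
  have "c \<longlonglongrightarrow> b"
  proof (rule ccontr)
    assume "\<not> c \<longlonglongrightarrow> b"
    then obtain e where e: "0 < e" "\<And>N. \<exists>k\<ge>N. e \<le> \<bar>c k - b\<bar>"
      unfolding LIMSEQ_def dist_real_def by (auto simp: not_less)
    then have inf: "infinite {k. e \<le> \<bar>c k - b\<bar>}"
      by (auto simp: infinite_nat_iff_unbounded_le)
    \<comment> \<open>If \<open>c\<close> stays away from \<open>b\<close> infinitely often, a
      convergent subsequence of these terms has a limit at distance at least \<open>e\<close> from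
      \<open>b\<close>: a second cluster point.\<close>
    define s where "s = enumerate {k. e \<le> \<bar>c k - b\<bar>}"
    have s: "strict_mono s" "e \<le> \<bar>c (s k) - b\<bar>" for k
      using inf enumerate_in_set[OF inf, of k] by (simp_all add: s_def strict_mono_enumerate)
    obtain a t where t: "strict_mono t" "(\<lambda>k. c (s (t k))) \<longlonglongrightarrow> a"
      using compact[of "\<lambda>k. c (s k)"] c01 by blast
    have st: "strict_mono (\<lambda>k. s (t k))"
      using s(1) t(1) by (simp add: strict_mono_def)
    have "a = b"
      by (rule antisym; rule Gram_cluster_points_le[where c=c]) (fact meas Z c c0 r t(2) st)+
    moreover have "e \<le> \<bar>a - b\<bar>"
      by (rule LIMSEQ_le_const[OF tendsto_rabs[OF tendsto_diff[OF t(2) tendsto_const]]]) (use s(2) in blast)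
    ultimately show False using e(1) by simp
  qed
  then show ?thesis ..
qed

section \<open>The Cauchy property of block averages in mean\<close>

text \<open>The variance of the absolute value is nonnegative; this turns second-moment bounds into
  bounds in mean.\<close>

lemma (in prob_space) expectation_abs_le:
  assumes "\<And>x. \<bar>f x\<bar> \<le> C" and [measurable]: "f \<in> borel_measurable M"
    and "expectation (\<lambda>x. (f x)\<^sup>2) \<le> e\<^sup>2" and "0 \<le> (e::real)"
  shows "expectation (\<lambda>x. \<bar>f x\<bar>) \<le> e"
proof -
  have int: "integrable M (\<lambda>x. \<bar>f x\<bar>)"
    using assms(1) by (intro integrable_const_bound[of _ C]) auto
  have int2: "integrable M (\<lambda>x. \<bar>f x\<bar>\<^sup>2)"
    using power_mono[OF assms(1), of _ 2] by (intro integrable_const_bound[of _ "C\<^sup>2"]) auto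
  have "0 \<le> variance (\<lambda>x. \<bar>f x\<bar>)" by (rule variance_positive)
  also have "\<dots> = expectation (\<lambda>x. \<bar>f x\<bar>\<^sup>2) - (expectation (\<lambda>x. \<bar>f x\<bar>))\<^sup>2"
    by (rule variance_eq[OF int int2])
  finally have "(expectation (\<lambda>x. \<bar>f x\<bar>))\<^sup>2 \<le> e\<^sup>2"
    using assms(3) by simp
  then show ?thesis using assms(4) by (rule power2_le_imp_le)
qed

text \<open>
  All indices of the block are at least \<open>m\<close>, so for large \<open>m\<close> the block lies in the future of any given
  \<open>n\<close>, and convergence of the Gram matrix can be used without a Cesaro argument.
\<close>

definition block_average :: "(nat \<Rightarrow> real) \<Rightarrow> nat \<Rightarrow> real" where
  "block_average z m = (\<Sum>i\<in>{m..2 * m}. z i) / real (Suc m)"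

lemma card_block: "card {m..2 * m} = Suc m" by simp

lemma block_average_bounds:
  assumes "\<And>k. z k \<in> {0..1}"
  shows "block_average z m \<in> {0..1}"
proof -
  have "(\<Sum>i\<in>{m..2 * m}. z i) \<le> (\<Sum>i\<in>{m..2 * m}. 1)"
    using assms by (intro sum_mono) auto
  moreover have "0 \<le> (\<Sum>i\<in>{m..2 * m}. z i)"
    using assms by (intro sum_nonneg) auto
  ultimately show ?thesis by (simp add: block_average_def)
qed

text \<open>Shifting changes the block sum by its two end terms only, since the difference
  telescopes. This will make the limit of the averages shift-invariant.\<close>

lemma block_average_Suc_diff:
  assumes "\<And>k. z k \<in> {0..1}"
  shows "(\<lambda>m. block_average (\<lambda>k. z (Suc k)) m - block_average z m) \<longlonglongrightarrow> 0"
proof (rule Lim_null_comparison)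
  have "\<bar>block_average (\<lambda>k. z (Suc k)) m - block_average z m\<bar> \<le> 1 / real (Suc m)" for m
  proof -
    have "(\<Sum>i\<in>{m..2 * m}. z (Suc i)) - (\<Sum>i\<in>{m..2 * m}. z i) = z (Suc (2 * m)) - z m"
      using sum_Suc_diff[of m "2 * m" z] by (simp add: sum_subtractf)
    then have "block_average (\<lambda>k. z (Suc k)) m - block_average z m
        = (z (Suc (2 * m)) - z m) / real (Suc m)"
      unfolding block_average_def by (simp only: diff_divide_distrib[symmetric])
    moreover have "\<bar>z (Suc (2 * m)) - z m\<bar> \<le> 1"
      using assms[of m] assms[of "Suc (2 * m)"] by auto
    ultimately show ?thesis by (simp add: divide_right_mono)
  qed
  then show "\<forall>\<^sub>F m in sequentially. norm (block_average (\<lambda>k. z (Suc k)) m - block_average z m)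
      \<le> 1 / real (Suc m)" by simp
  show "(\<lambda>m. 1 / real (Suc m)) \<longlonglongrightarrow> 0"
    using LIMSEQ_inverse_real_of_nat by (simp add: inverse_eq_divide)
qed

text \<open>The Gram entries \<open>c k\<close> converge to some \<open>b\<close>, so for late
  blocks the two square terms and the mixed term of \<open>second_moment_diff_averages\<close>
  nearly cancel.\<close>

lemma (in prob_space) block_averages_L1_Cauchy:
  fixes Z :: "nat \<Rightarrow> 'a \<Rightarrow> real"
  assumes meas [measurable]: "\<And>k. Z k \<in> borel_measurable M" and Z01: "\<And>k x. Z k x \<in> {0, 1}"
    and c: "\<And>k l. k < l \<Longrightarrow> expectation (\<lambda>x. Z k x * Z l x) = expectation (\<lambda>x. Z k x * Z (Suc k) x)"
    and "0 < e"
  shows "\<exists>N. \<forall>m\<ge>N. \<forall>l\<ge>N.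
    expectation (\<lambda>x. \<bar>block_average (\<lambda>k. Z k x) m - block_average (\<lambda>k. Z k x) l\<bar>) \<le> e"
proof -
  have Z: "Z k x \<in> {0..1}" for k x using Z01[of k x] by auto
  then have Z0: "0 \<le> Z k x" for k x by simp
  define c where "c k = expectation (\<lambda>x. Z k x * Z (Suc k) x)" for k
  have bd: "Z i x * Z j x \<in> {0..1}" for i j x
    using Z[of i x] Z[of j x] by (auto intro: mult_le_one)
  have int: "integrable M (\<lambda>x. Z i x * Z j x)" for i j
    using bd by (intro integrable_const_bound[of _ 1]) auto
  have c01: "c k \<in> {0..1}" for k
  proof -
    have "c k \<le> expectation (\<lambda>x. 1)" unfolding c_def
      using bd int by (intro integral_mono) auto
    moreover have "0 \<le> c k" unfolding c_def using Z0 by simp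
    ultimately show ?thesis by (simp add: prob_space)
  qed
  have ck: "expectation (\<lambda>x. Z k x * Z l x) = c k" if "k < l" for k l
    using c[OF that] by (simp add: c_def)
  have sym: "expectation (\<lambda>x. Z i x * Z j x) = c (min i j)" if "i \<noteq> j" for i j
    using ck[of i j] ck[of j i] that by (cases "i < j") (auto simp: min_def mult.commute)
  obtain b where b: "c \<longlonglongrightarrow> b"
    using Gram_convergent[where Z=Z and c=c, OF meas Z ck c01] by blast
  have "0 \<le> b" using b c01 by (auto intro!: LIMSEQ_le_const[OF b])
  \<comment> \<open>With all entries compared to the same \<open>b\<close>, the Gram part of the
    bound is \<open>4 * d\<close>; the block sizes add at most \<open>2 * d\<close>.\<close>
  define d where "d = e\<^sup>2 / 6"
  have d: "0 < d" using \<open>0 < e\<close> by (simp add: d_def)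
  obtain n where n: "1 / real (Suc n) < d"
    using reals_Archimedean[OF d] by (auto simp: inverse_eq_divide)
  obtain N1 where N1: "\<And>k. k \<ge> N1 \<Longrightarrow> \<bar>c k - b\<bar> < d"
    using LIMSEQ_D[OF b d] by auto
  define N where "N = max n N1"
  have gd: "\<bar>expectation (\<lambda>x. Z i x * Z j x) - b\<bar> < d" if "N \<le> i" "N \<le> j" "i \<noteq> j" for i j
    using N1[of "min i j"] that by (simp add: sym N_def)
  \<comment> \<open>The blocks for \<open>m\<close> and \<open>l\<close> may overlap, so the mixed
    term contains diagonal entries. For values in \<open>{0, 1}\<close> the product of two
    neighbours is at most the square of the first, which bounds the diagonal from below.\<close>
  have gl: "b - d \<le> expectation (\<lambda>x. Z i x * Z j x)" if "N \<le> i" "N \<le> j" for i j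
  proof (cases "i = j")
    case True
    have "expectation (\<lambda>x. Z i x * Z (Suc i) x) \<le> expectation (\<lambda>x. Z i x * Z i x)"
    proof (rule integral_mono[OF int int])
      fix x show "Z i x * Z (Suc i) x \<le> Z i x * Z i x"
        using Z01[of i x] Z01[of "Suc i" x] by auto
    qed
    then show ?thesis using gd[of i "Suc i"] that True by simp
  next
    case False
    then show ?thesis using gd[OF that] by simp
  qed
  have "expectation (\<lambda>x. \<bar>block_average (\<lambda>k. Z k x) m - block_average (\<lambda>k. Z k x) l\<bar>) \<le> e"
    if ml: "N \<le> m" "N \<le> l" for m l
  proof (rule expectation_abs_le[where C=1])
    show "\<bar>block_average (\<lambda>k. Z k x) m - block_average (\<lambda>k. Z k x) l\<bar> \<le> 1" for x
      using block_average_bounds[of "\<lambda>k. Z k x" m] block_average_bounds[of "\<lambda>k. Z k x" l] Z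
      by auto
    show "(\<lambda>x. block_average (\<lambda>k. Z k x) m - block_average (\<lambda>k. Z k x) l) \<in> borel_measurable M"
      unfolding block_average_def by measurable
    have "expectation (\<lambda>x. (block_average (\<lambda>k. Z k x) m - block_average (\<lambda>k. Z k x) l)\<^sup>2)
      \<le> (b + d) + (b + d) - 2 * (b - d) + 1 / card {m..2 * m} + 1 / card {l..2 * l}"
      unfolding block_average_def card_block[symmetric]
    proof (rule second_moment_diff_averages[OF meas Z])
      fix i j assume "i \<in> {m..2 * m}" "j \<in> {m..2 * m}" "i \<noteq> j"
      then show "expectation (\<lambda>x. Z i x * Z j x) \<le> b + d"
        using gd[of i j] ml by auto
    next
      fix i j assume "i \<in> {l..2 * l}" "j \<in> {l..2 * l}" "i \<noteq> j"
      then show "expectation (\<lambda>x. Z i x * Z j x) \<le> b + d"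
        using gd[of i j] ml by auto
    next
      fix i j assume "i \<in> {m..2 * m}" "j \<in> {l..2 * l}"
      then show "b - d \<le> expectation (\<lambda>x. Z i x * Z j x)"
        using gl[of i j] ml by auto
    qed (use \<open>0 \<le> b\<close> d in auto)
    also have "\<dots> \<le> 6 * d"
    proof -
      have "1 / real (Suc k) \<le> 1 / real (Suc n)" if "N \<le> k" for k
        using that by (simp add: N_def frac_le)
      from this[OF ml(1)] this[OF ml(2)] show ?thesis
        using n unfolding card_block by simp
    qed
    finally show "expectation (\<lambda>x. (block_average (\<lambda>k. Z k x) m - block_average (\<lambda>k. Z k x) l)\<^sup>2) \<le> e\<^sup>2"
      by (simp add: d_def)
  qed (use \<open>0 < e\<close> in simp)
  then show ?thesis by blast
qed

section \<open>Almost sure convergence along a subsequence\<close>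

text \<open>Choose \<open>r\<close> so that successive differences have mean absolute value at most
  \<open>(1/2) ^ j\<close>. Their absolute series has finite integral, so it is finite almost
  everywhere and the telescoping series converges.\<close>

lemma L1_Cauchy_AE_convergent_subseq:
  fixes f :: "nat \<Rightarrow> 'a \<Rightarrow> real"
  assumes int: "\<And>n. integrable M (f n)"
    and Cauchy: "\<And>e. 0 < e \<Longrightarrow> \<exists>N. \<forall>m\<ge>N. \<forall>l\<ge>N. (\<integral>x. \<bar>f m x - f l x\<bar> \<partial>M) \<le> e"
  shows "\<exists>r. strict_mono r \<and> (AE x in M. convergent (\<lambda>j. f (r j) x))"
proof -
  have [measurable]: "f n \<in> borel_measurable M" for n using int by auto
  have "\<exists>r. \<forall>j. (\<forall>m\<ge>r j. \<forall>l\<ge>r j. (\<integral>x. \<bar>f m x - f l x\<bar> \<partial>M) \<le> (1/2) ^ j) \<and> r j < r (Suc j)"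
  proof (rule dependent_nat_choice)
    show "\<exists>N. \<forall>m\<ge>N. \<forall>l\<ge>N. (\<integral>x. \<bar>f m x - f l x\<bar> \<partial>M) \<le> (1/2) ^ 0"
      using Cauchy[of 1] by simp
    fix R j :: nat
    obtain N where N: "\<forall>m\<ge>N. \<forall>l\<ge>N. (\<integral>x. \<bar>f m x - f l x\<bar> \<partial>M) \<le> (1/2) ^ Suc j"
      using Cauchy[of "(1/2) ^ Suc j"] by auto
    then show "\<exists>N. (\<forall>m\<ge>N. \<forall>l\<ge>N. (\<integral>x. \<bar>f m x - f l x\<bar> \<partial>M) \<le> (1/2) ^ Suc j) \<and> R < N"
      by (intro exI[of _ "max N (Suc R)"]) auto
  qed
  then obtain r where r: "\<And>j m l. r j \<le> m \<Longrightarrow> r j \<le> l \<Longrightarrow> (\<integral>x. \<bar>f m x - f l x\<bar> \<partial>M) \<le> (1/2) ^ j"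
    and "\<And>j. r j < r (Suc j)"
    by blast
  then have "strict_mono r" by (simp add: strict_mono_Suc_iff)
  define g where "g j x = f (r (Suc j)) x - f (r j) x" for j x
  have [measurable]: "g j \<in> borel_measurable M" for j unfolding g_def[abs_def] by measurable
  have g: "(\<integral>x. \<bar>g j x\<bar> \<partial>M) \<le> (1/2) ^ j" for j
    unfolding g_def using \<open>r j < r (Suc j)\<close> by (intro r) auto
  have intg: "integrable M (\<lambda>x. \<bar>g j x\<bar>)" for j
    unfolding g_def using int by auto
  have "(\<integral>\<^sup>+x. (\<Sum>j. ennreal \<bar>g j x\<bar>) \<partial>M) = (\<Sum>j. \<integral>\<^sup>+x. ennreal \<bar>g j x\<bar> \<partial>M)"
    by (rule nn_integral_suminf) measurable
  also have "\<dots> = (\<Sum>j. ennreal (\<integral>x. \<bar>g j x\<bar> \<partial>M))"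
    using intg by (simp add: nn_integral_eq_integral)
  also have "\<dots> \<le> (\<Sum>j. ennreal ((1/2) ^ j))"
    using g by (intro suminf_le ennreal_leI) auto
  also have "\<dots> = ennreal (\<Sum>j. (1/2) ^ j)"
    by (rule suminf_ennreal2) (auto intro: summable_geometric)
  also have "\<dots> < \<infinity>" by simp
  finally have "AE x in M. (\<Sum>j. ennreal \<bar>g j x\<bar>) \<noteq> \<infinity>"
    by (intro nn_integral_PInf_AE) auto
  then have "AE x in M. convergent (\<lambda>j. f (r j) x)"
  proof (rule eventually_mono)
    fix x assume "(\<Sum>j. ennreal \<bar>g j x\<bar>) \<noteq> \<infinity>"
    then have "summable (\<lambda>j. \<bar>g j x\<bar>)"
      by (intro summable_suminf_not_top) auto
    then have "summable (\<lambda>j. g j x)" by (rule summable_rabs_cancel)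
    then have "convergent (\<lambda>n. \<Sum>j<n. g j x)" by (simp add: summable_iff_convergent)
    then have "convergent (\<lambda>n. f (r n) x - f (r 0) x)"
      unfolding g_def sum_lessThan_telescope[of "\<lambda>n. f (r n) x"] .
    then show "convergent (\<lambda>n. f (r n) x)"
      by (simp add: convergent_diff_const_right_iff)
  qed
  with \<open>strict_mono r\<close> show ?thesis by blast
qed

subsection \<open>Conditioning on shift-invariant events\<close>

text \<open>The shift-invariant events already form a sigma-algebra, see
  \<open>sets_invariant_algebra\<close>; conditional expectations take it in the form of a
  measure.\<close>

definition invariant_algebra :: "'w measure \<Rightarrow> 'e measure \<Rightarrow> (nat \<Rightarrow> 'w \<Rightarrow> 'e) \<Rightarrow> 'w measure" where
  "invariant_algebra P E X = sigma (space P) (shift_invariant_sets P E X)"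

lemma seq_shift_space: "x \<in> space (seq_space E) \<Longrightarrow> seq_shift x \<in> space (seq_space E)"
  by (auto simp: seq_space_def space_PiM seq_shift_def)

lemma path_in_seq_space:
  assumes "\<And>n. X n \<in> measurable P E" "\<omega> \<in> space P"
  shows "(\<lambda>n. X n \<omega>) \<in> space (seq_space E)"
  using measurable_space[OF assms(1) assms(2)] by (auto simp: seq_space_def space_PiM)

lemma shift_invariant_setsI:
  assumes X: "\<And>n. X n \<in> measurable P E" and B: "B \<in> sets (seq_space E)"
    and inv: "\<And>x. x \<in> space (seq_space E) \<Longrightarrow> seq_shift x \<in> B \<longleftrightarrow> x \<in> B"
  shows "{\<omega> \<in> space P. (\<lambda>n. X n \<omega>) \<in> B} \<in> shift_invariant_sets P E X"
proof -
  have "seq_shift -` B \<inter> space (seq_space E) = B"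
    using inv sets.sets_into_space[OF B] by blast
  then show ?thesis using B unfolding shift_invariant_sets_def by blast
qed

lemma shift_invariant_setsE:
  assumes "H \<in> shift_invariant_sets P E X"
  obtains B where "H = {\<omega> \<in> space P. (\<lambda>n. X n \<omega>) \<in> B}" "B \<in> sets (seq_space E)"
    "\<And>x. x \<in> space (seq_space E) \<Longrightarrow> seq_shift x \<in> B \<longleftrightarrow> x \<in> B"
proof -
  obtain B where B: "H = {\<omega> \<in> space P. (\<lambda>n. X n \<omega>) \<in> B}" "B \<in> sets (seq_space E)"
    "seq_shift -` B \<inter> space (seq_space E) = B"
    using assms unfolding shift_invariant_sets_def by (elim CollectE exE conjE) (rule that)
  have "seq_shift x \<in> B \<longleftrightarrow> x \<in> B" if "x \<in> space (seq_space E)" for x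
    using B(3) that by blast
  with B(1,2) show thesis by (rule that)
qed

lemma shift_invariant_sets_subset:
  assumes X: "\<And>n. X n \<in> measurable P E"
  shows "shift_invariant_sets P E X \<subseteq> sets P"
proof
  fix H assume "H \<in> shift_invariant_sets P E X"
  then obtain B where B: "H = {\<omega> \<in> space P. (\<lambda>n. X n \<omega>) \<in> B}" "B \<in> sets (seq_space E)"
    by (rule shift_invariant_setsE) (rule that)
  have "H = (\<lambda>\<omega> n. X n \<omega>) -` B \<inter> space P" unfolding B(1) by blast
  then show "H \<in> sets P"
    using measurable_sets[OF measurable_seq_space[OF X] B(2)] by (simp only:)
qed

lemma sigma_algebra_shift_invariant_sets:
  assumes X: "\<And>n. X n \<in> measurable P E"
  shows "sigma_algebra (space P) (shift_invariant_sets P E X)"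
  unfolding sigma_algebra_iff2
proof (intro conjI allI impI ballI)
  show "shift_invariant_sets P E X \<subseteq> Pow (space P)"
    by (rule subset_trans[OF shift_invariant_sets_subset[of X P E, OF X] sets.space_closed])
  have "{\<omega> \<in> space P. (\<lambda>n. X n \<omega>) \<in> {}} \<in> shift_invariant_sets P E X"
    by (rule shift_invariant_setsI[OF X]) auto
  then show "{} \<in> shift_invariant_sets P E X" by simp
next
  fix H assume "H \<in> shift_invariant_sets P E X"
  then obtain B where B: "H = {\<omega> \<in> space P. (\<lambda>n. X n \<omega>) \<in> B}" "B \<in> sets (seq_space E)"
    "\<And>x. x \<in> space (seq_space E) \<Longrightarrow> seq_shift x \<in> B \<longleftrightarrow> x \<in> B"
    by (rule shift_invariant_setsE) (rule that)
  have "space P - H = {\<omega> \<in> space P. (\<lambda>n. X n \<omega>) \<in> space (seq_space E) - B}"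
    using path_in_seq_space[of X P E, OF X] unfolding B(1) by blast
  also have "\<dots> \<in> shift_invariant_sets P E X"
    using B(2,3) seq_shift_space by (intro shift_invariant_setsI[OF X]) auto
  finally show "space P - H \<in> shift_invariant_sets P E X" .
next
  fix H :: "nat \<Rightarrow> _" assume "range H \<subseteq> shift_invariant_sets P E X"
  then have H: "H i \<in> shift_invariant_sets P E X" for i by blast
  have "\<exists>B. H i = {\<omega> \<in> space P. (\<lambda>n. X n \<omega>) \<in> B} \<and> B \<in> sets (seq_space E) \<and>
    (\<forall>x \<in> space (seq_space E). seq_shift x \<in> B \<longleftrightarrow> x \<in> B)" for i
    using H[of i] by (rule shift_invariant_setsE) blast
  from choice[OF allI[OF this]] obtain B where "\<forall>i. H i = {\<omega> \<in> space P. (\<lambda>n. X n \<omega>) \<in> B i} \<and>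
    B i \<in> sets (seq_space E) \<and> (\<forall>x \<in> space (seq_space E). seq_shift x \<in> B i \<longleftrightarrow> x \<in> B i)" ..
  then have B: "\<And>i. H i = {\<omega> \<in> space P. (\<lambda>n. X n \<omega>) \<in> B i}"
    "\<And>i. B i \<in> sets (seq_space E)"
    "\<And>i x. x \<in> space (seq_space E) \<Longrightarrow> seq_shift x \<in> B i \<longleftrightarrow> x \<in> B i"
    by blast+
  have "(\<Union>i. H i) = {\<omega> \<in> space P. (\<lambda>n. X n \<omega>) \<in> (\<Union>i. B i)}"
    unfolding B(1) by blast
  also have "\<dots> \<in> shift_invariant_sets P E X"
    using B(2,3) by (intro shift_invariant_setsI[OF X]) auto
  finally show "(\<Union>i. H i) \<in> shift_invariant_sets P E X" .
qed

lemma space_invariant_algebra [simp]: "space (invariant_algebra P E X) = space P"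
  by (simp add: invariant_algebra_def space_measure_of_conv)

lemma sets_invariant_algebra:
  assumes "\<And>n. X n \<in> measurable P E"
  shows "sets (invariant_algebra P E X) = shift_invariant_sets P E X"
  unfolding invariant_algebra_def
  by (rule sigma_algebra.sets_measure_of_eq[OF sigma_algebra_shift_invariant_sets[OF assms]])

lemma subalgebra_invariant_algebra:
  assumes "\<And>n. X n \<in> measurable P E"
  shows "subalgebra P (invariant_algebra P E X)"
  using shift_invariant_sets_subset[of X P E, OF assms]
  by (simp add: subalgebra_def sets_invariant_algebra[of X P E, OF assms])

text \<open>Sublevel sets of a function that is invariant at every path are invariant path sets, so
  their preimages are invariant events.\<close>

lemma borel_measurable_invariant_algebra:
  fixes v :: "(nat \<Rightarrow> 'e) \<Rightarrow> real"
  assumes X: "\<And>n. X n \<in> measurable P E" and v: "v \<in> borel_measurable (seq_space E)"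
    and inv: "\<And>x. x \<in> space (seq_space E) \<Longrightarrow> v (seq_shift x) = v x"
  shows "(\<lambda>\<omega>. v (\<lambda>n. X n \<omega>)) \<in> borel_measurable (invariant_algebra P E X)"
  unfolding borel_measurable_iff_le
proof
  fix a
  have v': "{x \<in> space (seq_space E). v x \<le> a} \<in> sets (seq_space E)"
    using v unfolding borel_measurable_iff_le by blast
  have "{\<omega> \<in> space P. v (\<lambda>n. X n \<omega>) \<le> a}
      = {\<omega> \<in> space P. (\<lambda>n. X n \<omega>) \<in> {x \<in> space (seq_space E). v x \<le> a}}"
    using path_in_seq_space[of X P E, OF X] by blast
  also have "\<dots> \<in> shift_invariant_sets P E X"
    using inv seq_shift_space by (intro shift_invariant_setsI[OF X v']) auto
  finally show "{\<omega> \<in> space (invariant_algebra P E X). v (\<lambda>n. X n \<omega>) \<le> a} \<in> sets (invariant_algebra P E X)"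
    by (simp only: space_invariant_algebra sets_invariant_algebra[of X P E, OF X])
qed

section \<open>From c.i.d. under all invariant conditionings to exchangeability\<close>

context
  fixes P :: "'w measure" and E :: "'e measure" and X :: "nat \<Rightarrow> 'w \<Rightarrow> 'e"
  assumes prob_P: "prob_space P" and X: "\<And>n. X n \<in> measurable P E"
    and cid_invariant: "\<And>H. H \<in> shift_invariant_sets P E X \<Longrightarrow> measure P H > 0 \<Longrightarrow>
      cid (uniform_measure P H) E X"
begin

interpretation prob_space P by (rule prob_P)

interpretation finite_measure_subalgebra P "invariant_algebra P E X"
  by unfold_locales (rule subalgebra_invariant_algebra[of X P E, OF X])

abbreviation past :: "nat \<Rightarrow> (nat \<Rightarrow> 'e set) \<Rightarrow> 'w set" where
  "past n A \<equiv> {\<omega> \<in> space P. \<forall>i<n. X i \<omega> \<in> A i}"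

lemma X_Collect_measurable:
  assumes "B \<in> sets E"
  shows "{\<omega> \<in> space P. X k \<omega> \<in> B} \<in> sets P"
proof -
  have "{\<omega> \<in> space P. X k \<omega> \<in> B} = X k -` B \<inter> space P" by blast
  then show ?thesis using measurable_sets[OF X assms, of k] by (simp only:)
qed

lemma past_measurable:
  assumes "\<And>i. A i \<in> sets E"
  shows "past n A \<in> sets P"
proof -
  have "past n A = {\<omega> \<in> space P. \<forall>i\<in>{..<n}. X i \<omega> \<in> A i}" by blast
  also have "\<dots> \<in> sets P"
    by (rule sets.sets_Collect_finite_All[OF X_Collect_measurable[OF assms] finite_lessThan])
  finally show ?thesis .
qed

text \<open>For null \<open>H\<close> both sides vanish, so the identity holds on the whole
  invariant sigma-field and can be used to identify conditional expectations.\<close>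

lemma invariant_prob_eq:
  assumes H: "H \<in> shift_invariant_sets P E X" and "n \<le> k"
    and A: "\<And>i. A i \<in> sets E" and B: "B \<in> sets E"
  shows "measure P (H \<inter> (past n A \<inter> {\<omega> \<in> space P. X k \<omega> \<in> B}))
    = measure P (H \<inter> (past n A \<inter> {\<omega> \<in> space P. X n \<omega> \<in> B}))"
proof -
  have H': "H \<in> sets P" using H shift_invariant_sets_subset[of X P E, OF X] by blast
  have eq: "H \<inter> (past n A \<inter> {\<omega> \<in> space P. X j \<omega> \<in> B}) = {\<omega> \<in> H. (\<forall>i<n. X i \<omega> \<in> A i) \<and> X j \<omega> \<in> B}" for j
    using sets.sets_into_space[OF H'] by blast
  show ?thesis
  proof (cases "measure P H > 0")
    case True
    note cid_uniform_measure_iff[of P X E H, OF prob_P X H' True, THEN iffD1, OF cid_invariant[OF H True],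
        rule_format, of n k A B, OF \<open>n \<le> k\<close> A B]
    then show ?thesis by (simp only: eq)
  next
    case False
    then have "measure P H = 0" by (simp add: zero_less_measure_iff)
    then have "measure P (H \<inter> S) = 0" if "S \<in> sets P" for S
      using finite_measure_mono[of "H \<inter> S" H] H' that measure_nonneg[of P "H \<inter> S"] by simp
    from this[OF sets.Int[OF past_measurable[OF A] X_Collect_measurable[OF B]]]
    show ?thesis by (simp only:)
  qed
qed

definition hit :: "'e set \<Rightarrow> nat \<Rightarrow> 'w \<Rightarrow> real" where
  "hit B k = indicator {\<omega> \<in> space P. X k \<omega> \<in> B}"

lemma hit_measurable: "B \<in> sets E \<Longrightarrow> hit B k \<in> borel_measurable P"
  unfolding hit_def by (intro borel_measurable_indicator X_Collect_measurable)

lemma hit_01: "hit B k \<omega> \<in> {0, 1}" and hit_bounds: "0 \<le> hit B k \<omega>" "hit B k \<omega> \<le> 1"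
  by (auto simp: hit_def indicator_def)

text \<open>By \<open>invariant_prob_eq\<close> the events \<open>S k\<close> and \<open>S n\<close>
  have the same conditional probability given the invariant sigma-field, and the invariant factor
  \<open>h\<close> may be moved inside the conditioning.\<close>

lemma invariant_expectation_eq:
  assumes h: "h \<in> borel_measurable (invariant_algebra P E X)" "\<And>\<omega>. h \<omega> \<in> {0..1::real}" and "n \<le> k"
    and A: "\<And>i. A i \<in> sets E" and B: "B \<in> sets E"
  shows "expectation (\<lambda>\<omega>. h \<omega> * (indicator (past n A) \<omega> * hit B k \<omega>))
    = expectation (\<lambda>\<omega>. h \<omega> * (indicator (past n A) \<omega> * hit B n \<omega>))"
proof -
  let ?F = "invariant_algebra P E X"
  define S where "S j = past n A \<inter> {\<omega> \<in> space P. X j \<omega> \<in> B}" for j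
  have S: "S j \<in> sets P" for j
    unfolding S_def using past_measurable[of A n] X_Collect_measurable[OF B] A by blast
  have ind: "indicator (past n A) \<omega> * hit B j \<omega> = indicator (S j) \<omega>" for j \<omega>
    unfolding hit_def S_def by (rule indicator_inter_arith[symmetric])
  define U where "U j = (indicator (S j) :: 'w \<Rightarrow> real)" for j
  have U: "U j \<in> borel_measurable P" for j
    unfolding U_def using S by (intro borel_measurable_indicator)
  have intU: "integrable P (U j)" for j
    unfolding U_def
    by (intro integrable_const_bound[of _ 1] borel_measurable_indicator S) (auto simp: indicator_def)
  have hP: "h \<in> borel_measurable P"
    using h(1) by (rule measurable_from_subalg[OF subalg])
  have inthU: "integrable P (\<lambda>\<omega>. h \<omega> * U j \<omega>)" for j
    using h(2) by (intro integrable_const_bound[of _ 1] borel_measurable_times hP U)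
      (auto simp: U_def indicator_def)
  have eqA: "(\<integral>\<omega>\<in>H. U j \<omega> \<partial>P) = measure P (H \<inter> S j)" if "H \<in> sets ?F" for H j
  proof -
    have "H \<in> sets P" using that subalg by (auto simp: subalgebra_def)
    then have "H \<inter> S j \<inter> space P = H \<inter> S j" using sets.sets_into_space by blast
    then show ?thesis
      by (simp add: set_lebesgue_integral_def U_def flip: indicator_inter_arith)
  qed
  have ce: "AE \<omega> in P. real_cond_exp P ?F (U k) \<omega> = real_cond_exp P ?F (U n) \<omega>"
  proof (rule real_cond_exp_charact)
    fix H assume H: "H \<in> sets ?F"
    have "(\<integral>\<omega>\<in>H. U k \<omega> \<partial>P) = (\<integral>\<omega>\<in>H. U n \<omega> \<partial>P)"
      unfolding eqA[OF H] S_def using H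
      by (intro invariant_prob_eq[OF _ \<open>n \<le> k\<close> A B]) (simp add: sets_invariant_algebra[of X P E, OF X])
    also have "\<dots> = (\<integral>\<omega>\<in>H. real_cond_exp P ?F (U n) \<omega> \<partial>P)"
      by (rule real_cond_exp_intA[OF intU H])
    finally show "(\<integral>\<omega>\<in>H. U k \<omega> \<partial>P) = (\<integral>\<omega>\<in>H. real_cond_exp P ?F (U n) \<omega> \<partial>P)" .
  qed (rule intU real_cond_exp_int(1)[OF intU] borel_measurable_cond_exp)+
  have "expectation (\<lambda>\<omega>. h \<omega> * U k \<omega>) = expectation (\<lambda>\<omega>. h \<omega> * real_cond_exp P ?F (U k) \<omega>)"
    by (rule real_cond_exp_intg(2)[OF inthU h(1) U, symmetric])
  also have "\<dots> = expectation (\<lambda>\<omega>. h \<omega> * real_cond_exp P ?F (U n) \<omega>)"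
    using ce hP by (intro integral_cong_AE borel_measurable_times borel_measurable_cond_exp2) auto
  also have "\<dots> = expectation (\<lambda>\<omega>. h \<omega> * U n \<omega>)"
    by (rule real_cond_exp_intg(2)[OF inthU h(1) U])
  finally show ?thesis by (simp only: ind U_def)
qed

text \<open>Take \<open>h = 1\<close> and a past of length \<open>Suc k\<close> constrained at
  coordinate \<open>k\<close> alone; then \<open>l\<close> may be replaced by the first index after
  that past.\<close>

lemma Gram_hit:
  assumes B: "B \<in> sets E" and "k < l"
  shows "expectation (\<lambda>\<omega>. hit B k \<omega> * hit B l \<omega>) = expectation (\<lambda>\<omega>. hit B k \<omega> * hit B (Suc k) \<omega>)"
proof -
  define A where "A i = (if i = k then B else space E)" for i
  have A: "A i \<in> sets E" for i using B by (simp add: A_def)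
  have "past (Suc k) A = {\<omega> \<in> space P. X k \<omega> \<in> B}"
    using measurable_space[OF X] unfolding A_def by (auto simp: less_Suc_eq)
  then have "indicator (past (Suc k) A) \<omega> = hit B k \<omega>" for \<omega>
    by (simp only: hit_def)
  with invariant_expectation_eq[of "\<lambda>_. 1" "Suc k" l A B, OF _ _ _ A B] \<open>k < l\<close> show ?thesis
    by (simp only: Suc_le_eq mult_1_left borel_measurable_const atLeastAtMost_iff) simp
qed

text \<open>This class of weights is closed under products, so limit variables already split off can
  be absorbed into the weight.\<close>

definition unit_invariant :: "('w \<Rightarrow> real) \<Rightarrow> bool" where
  "unit_invariant h \<longleftrightarrow> h \<in> borel_measurable (invariant_algebra P E X) \<and> (\<forall>\<omega>. h \<omega> \<in> {0..1})"

text \<open>\<open>V\<close> is the almost sure limit of block averages of \<open>hit B\<close>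
  along a subsequence. For \<open>k \<ge> n\<close>, replacing \<open>hit B n\<close> by
  \<open>hit B k\<close> preserves the expectation, hence so does replacing it by the average over a
  block starting at or after \<open>n\<close>; dominated convergence then yields
  \<open>V\<close>.\<close>

lemma directing_variable:
  assumes B: "B \<in> sets E"
  shows "\<exists>V. unit_invariant V \<and> (\<forall>h n A. unit_invariant h \<longrightarrow> (\<forall>i. A i \<in> sets E) \<longrightarrow>
      expectation (\<lambda>\<omega>. h \<omega> * (indicator (past n A) \<omega> * hit B n \<omega>))
      = expectation (\<lambda>\<omega>. h \<omega> * (indicator (past n A) \<omega> * V \<omega>)))"
proof -
  define T where "T m \<omega> = block_average (\<lambda>k. hit B k \<omega>) m" for m \<omega>
  note Zm = hit_measurable[OF B]
  have T_meas: "T m \<in> borel_measurable P" for m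
    unfolding T_def[abs_def] block_average_def
    by (intro borel_measurable_divide borel_measurable_sum Zm borel_measurable_const)
  have T01: "T m \<omega> \<in> {0..1}" for m \<omega>
    unfolding T_def by (rule block_average_bounds) (simp add: hit_bounds)
  have "\<exists>r. strict_mono r \<and> (AE \<omega> in P. convergent (\<lambda>j. T (r j) \<omega>))"
  proof (rule L1_Cauchy_AE_convergent_subseq)
    show "integrable P (T m)" for m
      using T01 by (intro integrable_const_bound[of _ 1] T_meas) auto
    show "\<exists>N. \<forall>m\<ge>N. \<forall>l\<ge>N. expectation (\<lambda>\<omega>. \<bar>T m \<omega> - T l \<omega>\<bar>) \<le> e" if "0 < e" for e
      unfolding T_def by (rule block_averages_L1_Cauchy[where Z="hit B", OF Zm hit_01 Gram_hit[OF B] that])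
  qed
  then obtain r where r: "strict_mono r" and conv: "AE \<omega> in P. convergent (\<lambda>j. T (r j) \<omega>)"
    by blast
  define z where "z x k = (indicator B (x k) :: real)" for x :: "nat \<Rightarrow> 'e" and k
  \<comment> \<open>\<open>lim\<close> is an arbitrary real where the averages diverge; clipping keeps \<open>v\<close> in the unit interval.\<close>
  define v where "v x = max 0 (min 1 (lim (\<lambda>j. block_average (z x) (r j))))" for x
  define V where "V \<omega> = v (\<lambda>n. X n \<omega>)" for \<omega>
  have z01: "z x k \<in> {0..1}" for x k by (simp add: z_def indicator_def)
  have zm: "(\<lambda>x. z x k) \<in> borel_measurable (seq_space E)" for k
  proof -
    have "(\<lambda>x. x k) \<in> measurable (seq_space E) E" unfolding seq_space_def by simp
    from measurable_compose[OF this borel_measurable_indicator[OF B]] show ?thesis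
      by (simp only: z_def)
  qed
  have v_meas: "v \<in> borel_measurable (seq_space E)"
    unfolding v_def[abs_def] block_average_def
    by (intro borel_measurable_max borel_measurable_min borel_measurable_const borel_measurable_lim_metric
        borel_measurable_divide borel_measurable_sum zm)
  \<comment> \<open>Invariance must hold at every path, not just almost surely. The averages of the
    path and of its shift differ by a null sequence, so they have the same limits; when there is
    none, \<open>lim\<close> still denotes the same real for both.\<close>
  have v_inv: "v (seq_shift x) = v x" for x
  proof -
    have z_shift: "z (seq_shift x) = (\<lambda>k. z x (Suc k))"
      by (simp add: z_def seq_shift_def fun_eq_iff)
    have "(\<lambda>m. block_average (z (seq_shift x)) m - block_average (z x) m) \<longlonglongrightarrow> 0"
      unfolding z_shift by (rule block_average_Suc_diff[of "z x", OF z01])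
    from LIMSEQ_subseq_LIMSEQ[OF this r]
    have d: "(\<lambda>j. block_average (z (seq_shift x)) (r j) - block_average (z x) (r j)) \<longlonglongrightarrow> 0"
      by (simp add: o_def)
    have "(\<lambda>j. block_average (z (seq_shift x)) (r j)) \<longlonglongrightarrow> L
      \<longleftrightarrow> (\<lambda>j. block_average (z x) (r j)) \<longlonglongrightarrow> L" for L
      using Lim_transform[OF _ d] Lim_transform2[OF _ d] by blast
    then show ?thesis by (simp add: v_def lim_def)
  qed
  have V_meas: "V \<in> borel_measurable (invariant_algebra P E X)"
    unfolding V_def[abs_def] by (rule borel_measurable_invariant_algebra[OF X v_meas v_inv])
  have V01: "V \<omega> \<in> {0..1}" for \<omega> by (simp add: V_def v_def)
  have TV: "AE \<omega> in P. (\<lambda>j. T (r j) \<omega>) \<longlonglongrightarrow> V \<omega>"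
    using conv AE_space
  proof eventually_elim
    case (elim \<omega>)
    have "z (\<lambda>n. X n \<omega>) = (\<lambda>k. hit B k \<omega>)"
      using elim(2) by (simp add: fun_eq_iff z_def hit_def indicator_def)
    then have "T m \<omega> = block_average (z (\<lambda>n. X n \<omega>)) m" for m
      by (simp add: T_def)
    then have V_eq: "V \<omega> = max 0 (min 1 (lim (\<lambda>j. T (r j) \<omega>)))"
      by (simp add: V_def v_def)
    have l: "(\<lambda>j. T (r j) \<omega>) \<longlonglongrightarrow> lim (\<lambda>j. T (r j) \<omega>)"
      using elim(1) by (simp add: convergent_LIMSEQ_iff)
    moreover have "lim (\<lambda>j. T (r j) \<omega>) \<in> {0..1}"
      using T01 by (intro closed_sequentially[OF closed_atLeastAtMost _ l]) auto
    ultimately show ?case by (simp add: V_eq)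
  qed
  have "expectation (\<lambda>\<omega>. h \<omega> * (indicator (past n A) \<omega> * hit B n \<omega>))
      = expectation (\<lambda>\<omega>. h \<omega> * (indicator (past n A) \<omega> * V \<omega>))"
    if h: "h \<in> borel_measurable (invariant_algebra P E X)" and h01: "\<And>\<omega>. h \<omega> \<in> {0..1::real}"
      and A: "\<And>i. A i \<in> sets E" for h n A
  proof -
    let ?D = "\<lambda>\<omega>. indicator (past n A) \<omega> :: real"
    let ?c = "expectation (\<lambda>\<omega>. h \<omega> * (?D \<omega> * hit B n \<omega>))"
    have hP: "h \<in> borel_measurable P"
      using h by (rule measurable_from_subalg[OF subalg])
    have VP: "V \<in> borel_measurable P"
      using V_meas by (rule measurable_from_subalg[OF subalg])
    have D: "?D \<in> borel_measurable P"
      using past_measurable[of A n] A by (intro borel_measurable_indicator) blast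
    have bd: "\<bar>h \<omega> * (?D \<omega> * y)\<bar> \<le> 1" if "y \<in> {0..1}" for y \<omega>
      using h01[of \<omega>] that by (auto simp: indicator_def abs_mult mult_le_one)
    have "expectation (\<lambda>\<omega>. h \<omega> * (?D \<omega> * T m \<omega>)) = ?c" if "n \<le> m" for m
    proof -
      have int: "integrable P (\<lambda>\<omega>. h \<omega> * (?D \<omega> * hit B k \<omega>))" for k
        using bd hit_bounds by (intro integrable_const_bound[of _ 1] borel_measurable_times hP D Zm) auto
      have "expectation (\<lambda>\<omega>. h \<omega> * (?D \<omega> * T m \<omega>))
          = expectation (\<lambda>\<omega>. (\<Sum>k\<in>{m..2*m}. h \<omega> * (?D \<omega> * hit B k \<omega>)) / real (Suc m))"
        unfolding T_def block_average_def by (simp only: sum_distrib_left times_divide_eq_right)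
      also have "\<dots> = (\<Sum>k\<in>{m..2*m}. expectation (\<lambda>\<omega>. h \<omega> * (?D \<omega> * hit B k \<omega>))) / real (Suc m)"
        using int by (simp only: Bochner_Integration.integral_divide_zero Bochner_Integration.integral_sum)
      also have "\<dots> = (\<Sum>k\<in>{m..2*m}. ?c) / real (Suc m)"
        using \<open>n \<le> m\<close> A
        by (intro arg_cong2[where f="(/)"] sum.cong refl invariant_expectation_eq[OF h h01 _ _ B]) auto
      also have "\<dots> = ?c" by (simp only: sum_constant card_block) simp
      finally show ?thesis .
    qed
    moreover have "n \<le> r j" if "n \<le> j" for j
      using seq_suble[OF r, of j] that by simp
    ultimately have "\<forall>\<^sub>F j in sequentially. expectation (\<lambda>\<omega>. h \<omega> * (?D \<omega> * T (r j) \<omega>)) = ?c"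
      by (auto simp: eventually_sequentially)
    then have lim1: "(\<lambda>j. expectation (\<lambda>\<omega>. h \<omega> * (?D \<omega> * T (r j) \<omega>))) \<longlonglongrightarrow> ?c"
      by (rule tendsto_eventually)
    have lim2: "(\<lambda>j. expectation (\<lambda>\<omega>. h \<omega> * (?D \<omega> * T (r j) \<omega>)))
      \<longlonglongrightarrow> expectation (\<lambda>\<omega>. h \<omega> * (?D \<omega> * V \<omega>))"
    proof (rule integral_dominated_convergence[where w="\<lambda>_. 1"])
      show "AE \<omega> in P. (\<lambda>j. h \<omega> * (?D \<omega> * T (r j) \<omega>)) \<longlonglongrightarrow> h \<omega> * (?D \<omega> * V \<omega>)"
        using TV by (rule eventually_mono) (intro tendsto_mult tendsto_const)
      show "AE \<omega> in P. norm (h \<omega> * (?D \<omega> * T (r j) \<omega>)) \<le> 1" for j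
        using bd[OF T01] by (intro AE_I2) (simp only: real_norm_def)
    qed (intro borel_measurable_times hP D VP T_meas, intro borel_measurable_times hP D VP T_meas, simp)
    show ?thesis by (rule LIMSEQ_unique[OF lim1 lim2])
  qed
  moreover have "unit_invariant V" using V_meas V01 by (simp add: unit_invariant_def)
  ultimately show ?thesis unfolding unit_invariant_def by blast
qed

text \<open>Peel off the last coordinate: replace its indicator by \<open>V (A n)\<close>, absorb
  that factor into the weight, and apply the induction hypothesis, which is therefore stated for all
  weights. \<open>V\<close> depends on the set and not on the coordinate, so the product is
  symmetric in the sets.\<close>

lemma past_prob_eq_expectation_prod:
  "\<exists>V. \<forall>n A. (\<forall>i. A i \<in> sets E) \<longrightarrow> measure P (past n A) = expectation (\<lambda>\<omega>. \<Prod>i<n. V (A i) \<omega>)"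
proof -
  from bchoice[OF ballI[OF directing_variable]] obtain V
    where V': "\<forall>B\<in>sets E. unit_invariant (V B) \<and> (\<forall>h n A. unit_invariant h \<longrightarrow> (\<forall>i. A i \<in> sets E) \<longrightarrow>
      expectation (\<lambda>\<omega>. h \<omega> * (indicator (past n A) \<omega> * hit B n \<omega>))
      = expectation (\<lambda>\<omega>. h \<omega> * (indicator (past n A) \<omega> * V B \<omega>)))" ..
  note V = V'[rule_format, THEN conjunct1] and step = V'[rule_format, THEN conjunct2, rule_format]
  have main: "expectation (\<lambda>\<omega>. h \<omega> * indicator (past n A) \<omega>) = expectation (\<lambda>\<omega>. h \<omega> * (\<Prod>i<n. V (A i) \<omega>))"
    if A: "\<forall>i. A i \<in> sets E" and h: "unit_invariant h" for n A h
    using h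
  proof (induction n arbitrary: h)
    case 0
    show ?case by (rule Bochner_Integration.integral_cong) auto
  next
    case (Suc n)
    have An: "A n \<in> sets E" using A by blast
    have ok: "unit_invariant (\<lambda>\<omega>. h \<omega> * V (A n) \<omega>)"
      using Suc.prems V[OF An] unfolding unit_invariant_def by (auto intro: mult_le_one)
    have "indicator (past (Suc n) A) \<omega> = indicator (past n A) \<omega> * hit (A n) n \<omega>" for \<omega>
      by (auto simp: hit_def indicator_def less_Suc_eq)
    then have "expectation (\<lambda>\<omega>. h \<omega> * indicator (past (Suc n) A) \<omega>)
        = expectation (\<lambda>\<omega>. h \<omega> * (indicator (past n A) \<omega> * hit (A n) n \<omega>))" by (simp only:)
    also have "\<dots> = expectation (\<lambda>\<omega>. h \<omega> * (indicator (past n A) \<omega> * V (A n) \<omega>))"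
      by (rule step[OF An Suc.prems A[rule_format]])
    also have "\<dots> = expectation (\<lambda>\<omega>. (h \<omega> * V (A n) \<omega>) * indicator (past n A) \<omega>)"
      by (simp only: ac_simps)
    also have "\<dots> = expectation (\<lambda>\<omega>. (h \<omega> * V (A n) \<omega>) * (\<Prod>i<n. V (A i) \<omega>))"
      by (rule Suc.IH[OF ok])
    also have "\<dots> = expectation (\<lambda>\<omega>. h \<omega> * (\<Prod>i<Suc n. V (A i) \<omega>))"
      by (simp only: prod.lessThan_Suc ac_simps)
    finally show ?case .
  qed
  have one: "unit_invariant (\<lambda>_. 1)" by (simp add: unit_invariant_def)
  have "measure P (past n A) = expectation (\<lambda>\<omega>. \<Prod>i<n. V (A i) \<omega>)" if A: "\<forall>i. A i \<in> sets E" for n A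
  proof -
    have "past n A \<inter> space P = past n A" by blast
    then have "measure P (past n A) = expectation (\<lambda>\<omega>. 1 * indicator (past n A) \<omega>)"
      unfolding mult_1_left Bochner_Integration.integral_indicator by (simp only:)
    also have "\<dots> = expectation (\<lambda>\<omega>. 1 * (\<Prod>i<n. V (A i) \<omega>))" by (rule main[OF A one])
    finally show ?thesis by (simp only: mult_1_left)
  qed
  then show ?thesis by blast
qed

lemma cid_invariant_imp_exchangeable: "exchangeable P E X"
  unfolding exchangeable_def
proof (intro allI impI distr_seq_space_eqI[OF prob_P X X])
  fix \<tau> N and A :: "nat \<Rightarrow> 'e set"
  assume \<tau>: "finite_permutation \<tau>" and A: "\<And>i. A i \<in> sets E"
  obtain V where V: "\<And>n A. (\<forall>i. A i \<in> sets E) \<Longrightarrow> measure P (past n A) = expectation (\<lambda>\<omega>. \<Prod>i<n. V (A i) \<omega>)"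
    using past_prob_eq_expectation_prod by blast
  have bij: "bij \<tau>" using \<tau> by (simp add: finite_permutation_def)
  \<comment> \<open>Beyond \<open>N\<close> and beyond the moved points, so \<tau> permutes the
    indices below \<open>M\<close>. Padding \<open>A\<close> with \<open>space E\<close> up to
    \<open>M\<close> makes the rearranged event a past event with permuted sets.\<close>
  obtain M where M: "{..<N} \<union> {n. \<tau> n \<noteq> n} \<subseteq> {..<M}"
    using \<tau> finite_nat_iff_bounded[of "{..<N} \<union> {n. \<tau> n \<noteq> n}"] by (auto simp: finite_permutation_def)
  have fix_ge: "\<tau> n = n" if "M \<le> n" for n
    using M that by (metis (mono_tags) UnI2 lessThan_iff linorder_not_le mem_Collect_eq subsetD)
  \<comment> \<open>Points from \<open>M\<close> on are fixed, so by bijectivity no smaller point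
    can be sent there.\<close>
  have lt: "\<tau> n < M \<longleftrightarrow> n < M" for n
    using fix_ge bij by (metis bij_pointE linorder_not_le)
  have bijM: "bij_betw \<tau> {..<M} {..<M}"
  proof (rule bij_betw_imageI)
    show "inj_on \<tau> {..<M}" using bij by (rule inj_on_subset[OF bij_is_inj]) simp
    have "\<tau> -` {..<M} = {..<M}" using lt by (simp add: set_eq_iff)
    then show "\<tau> ` {..<M} = {..<M}"
      using surj_image_vimage_eq[OF bij_is_surj[OF bij], of "{..<M}"] by (simp only:)
  qed
  define A' where "A' i = (if i < N then A i else space E)" for i
  define \<rho> where "\<rho> = inv \<tau>"
  have \<rho>: "\<rho> (\<tau> i) = i" "\<tau> (\<rho> i) = i" for i
    using bij by (simp_all add: \<rho>_def bij_is_inj bij_is_surj surj_f_inv_f)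
  have A': "\<forall>i. A' i \<in> sets E" "\<forall>i. A' (\<rho> i) \<in> sets E" using A by (auto simp: A'_def)
  have ext: "(\<forall>i<N. X (\<sigma> i) \<omega> \<in> A i) \<longleftrightarrow> (\<forall>i<M. X (\<sigma> i) \<omega> \<in> A' i)" if "\<omega> \<in> space P" for \<sigma> \<omega>
    using M measurable_space[OF X that] by (auto simp: A'_def subset_iff)
  have perm: "(\<forall>i<M. X (\<tau> i) \<omega> \<in> A' i) \<longleftrightarrow> (\<forall>j<M. X j \<omega> \<in> A' (\<rho> j))" for \<omega>
  proof
    assume L: "\<forall>i<M. X (\<tau> i) \<omega> \<in> A' i"
    show "\<forall>j<M. X j \<omega> \<in> A' (\<rho> j)"
    proof (intro allI impI)
      fix j assume "j < M"
      then have "\<rho> j < M" using lt[of "\<rho> j"] by (simp only: \<rho>)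
      with L have "X (\<tau> (\<rho> j)) \<omega> \<in> A' (\<rho> j)" by blast
      then show "X j \<omega> \<in> A' (\<rho> j)" by (simp only: \<rho>)
    qed
  next
    assume R: "\<forall>j<M. X j \<omega> \<in> A' (\<rho> j)"
    show "\<forall>i<M. X (\<tau> i) \<omega> \<in> A' i"
    proof (intro allI impI)
      fix i assume "i < M"
      then have "\<tau> i < M" by (simp only: lt)
      with R have "X (\<tau> i) \<omega> \<in> A' (\<rho> (\<tau> i))" by blast
      then show "X (\<tau> i) \<omega> \<in> A' i" by (simp only: \<rho>)
    qed
  qed
  have "{\<omega> \<in> space P. \<forall>i<N. X (\<tau> i) \<omega> \<in> A i} = past M (\<lambda>j. A' (\<rho> j))"
    by (rule Collect_cong) (simp only: ext[of _ \<tau>] perm cong: conj_cong)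
  then have "measure P {\<omega> \<in> space P. \<forall>i<N. X (\<tau> i) \<omega> \<in> A i}
      = expectation (\<lambda>\<omega>. \<Prod>j<M. V (A' (\<rho> j)) \<omega>)"
    using V[OF A'(2)] by (simp only:)
  also have "\<dots> = expectation (\<lambda>\<omega>. \<Prod>i<M. V (A' i) \<omega>)"
  proof -
    have "(\<Prod>j<M. V (A' (\<rho> j)) \<omega>) = (\<Prod>i<M. V (A' i) \<omega>)" for \<omega>
      using prod.reindex_bij_betw[OF bijM, of "\<lambda>j. V (A' (\<rho> j)) \<omega>"] by (simp only: \<rho>)
    then show ?thesis by (simp only:)
  qed
  also have "\<dots> = measure P (past M A')" using V[OF A'(1)] by (simp only:)
  also have "past M A' = {\<omega> \<in> space P. \<forall>i<N. X i \<omega> \<in> A i}"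
    by (rule Collect_cong) (simp only: ext[of _ "\<lambda>i. i"] cong: conj_cong)
  finally show "measure P {\<omega> \<in> space P. \<forall>i<N. X (\<tau> i) \<omega> \<in> A i}
    = measure P {\<omega> \<in> space P. \<forall>i<N. X i \<omega> \<in> A i}" .
qed

end

theorem theorem2p8:
  fixes P :: "'w measure" and E :: "'e measure" and X :: "nat \<Rightarrow> 'w \<Rightarrow> 'e"
  assumes "prob_space P"
    and "\<And>n. X n \<in> measurable P E"
  shows "(exchangeable P E X \<longleftrightarrow>
            (\<forall>H \<in> shift_invariant_sets P E X. measure P H > 0 \<longrightarrow> cid (uniform_measure P H) E X)) \<and>
         (exchangeable P E X \<longleftrightarrow>
            (\<forall>\<tau>. finite_permutation \<tau> \<longrightarrow> cid P E (\<lambda>n. X (\<tau> n))))"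
proof -
  note P = assms(1) and X = assms(2)
  have "cid P E (\<lambda>n. X (\<tau> n))" if "exchangeable P E X" "finite_permutation \<tau>" for \<tau>
    by (rule exchangeable_imp_cid_permute[OF P X that])
  moreover have "exchangeable P E X" if "\<And>\<tau>. finite_permutation \<tau> \<Longrightarrow> cid P E (\<lambda>n. X (\<tau> n))"
    by (rule cid_permute_imp_exchangeable[OF P X that])
  moreover have "cid (uniform_measure P H) E X"
    if "exchangeable P E X" "H \<in> shift_invariant_sets P E X" "measure P H > 0" for H
    by (rule exchangeable_imp_cid_uniform_measure[OF P X that])
  moreover have "exchangeable P E X"
    if "\<And>H. H \<in> shift_invariant_sets P E X \<Longrightarrow> measure P H > 0 \<Longrightarrow> cid (uniform_measure P H) E X"
    by (rule cid_invariant_imp_exchangeable[OF P X that])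
  ultimately show ?thesis by blast
qed

end
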